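(* Suppose $\nu_{\hat D}$ is a probability measure of mean one supported on two atoms $\alpha>\eta>0$ (each of positive mass), and let $\mu=\nu_{\hat D}\boxtimes\sigma_{\mathrm{sc}}$, with $\sigma_{\mathrm{sc}}$ the standard semicircle law (supported on $[-2,2]$). Then the support $\mathrm{supp}(\mu)$ is disconnected if and only if $$\alpha>\eta\left[\frac{3}{1-(1-\eta)^{1/3}}-1\right].$$ Moreover, when this inequality holds, $\mathrm{supp}(\mu)\cap\mathbb R_+$ consists of exactly two disjoint intervals.
   Context: $\mathbb R_+=[0,\infty)$, and $\mathrm{supp}(\mu)$ is the (closed) topological support of $\mu$. Free multiplicative convolution: for a probability measure $\varphi$ let $m_\varphi(z)=\int\frac{zt}{1-zt}\,d\varphi(t)$. If $\varphi\ne\delta_0$ is supported on $\mathbb R_+$, $m_\varphi$ is injective on $\{\Re z<0\}$; if $\psi\neq\delta_0$ is symmetric on $\mathbb R$, $m_\psi$ is injective on $\{z:\Im z>|\Re z|\}$. With $m^{-1}$ the inverse of the respective restriction, the $S$-transform is $S(w)=(1+w^{-1})\,m^{-1}(w)$. For $\varphi\ne\delta_0$ on $\mathbb R_+$ and $\psi\ne\delta_0$ symmetric, $\varphi\boxtimes\psi$ is the unique (symmetric) probability measure on $\mathbb R$ with $S_{\varphi\boxtimes\psi}(w)=S_\varphi(w)S_\psi(w)$ on the common domain of these transforms (which contains an interval $(-\varepsilon,0)$). *)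

theory Defs
  imports "HOL-Probability.Probability"
begin

definition measure_support :: "real measure \<Rightarrow> real set" where
  "measure_support \<mu> = {x. \<forall>U. open U \<longrightarrow> x \<in> U \<longrightarrow> emeasure \<mu> U > 0}"

definition symmetric_measure :: "real measure \<Rightarrow> bool" where
  "symmetric_measure \<mu> \<longleftrightarrow> distr \<mu> borel uminus = \<mu>"

definition standard_semicircle :: "real measure" where
  "standard_semicircle =
     density lborel (\<lambda>x. ennreal (indicator {-2..2} x * sqrt (4 - x\<^sup>2) / (2 * pi)))"

definition m_transform :: "real measure \<Rightarrow> complex \<Rightarrow> complex" where
  "m_transform \<phi> z =
     (\<integral>t. z * complex_of_real t / (1 - z * complex_of_real t) \<partial>\<phi>)"

text \<open>
  The moment transform is inverted on the left half-plane for a measure on the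
  nonnegative half-line, and on the sector around the positive imaginary axis for
  a symmetric measure.
\<close>

definition left_half_plane :: "complex set" where
  "left_half_plane = {z. Re z < 0}"

definition upper_sector :: "complex set" where
  "upper_sector = {z. Im z > \<bar>Re z\<bar>}"

text \<open>
  The first argument is the region to which the moment transform is restricted
  before it is inverted. The value is meaningful only for \<open>w\<close> in the image of
  that region; it does not contain 0 unless \<open>\<phi>\<close> is the point mass at 0.
\<close>

definition S_transform :: "complex set \<Rightarrow> real measure \<Rightarrow> complex \<Rightarrow> complex" where
  "S_transform A \<phi> w = (1 + inverse w) * inv_into A (m_transform \<phi>) w"

text \<open>
  \<open>\<mu>\<close> is the free multiplicative convolution of \<open>\<phi>\<close> (a probability measure on the
  nonnegative half-line) and \<open>\<psi>\<close> (a symmetric one), both different from the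
  point mass at 0. For such \<open>\<phi>\<close> and \<open>\<psi>\<close> exactly one \<open>\<mu>\<close> satisfies this predicate:
  the three domains all contain an interval to the left of 0, and the S-transform
  there determines a symmetric measure. The point mass at 0 has to be
  excluded for \<open>\<mu>\<close>, because the image of its moment transform is \<open>{0}\<close> and
  the identity would hold vacuously.
\<close>

definition is_free_mult_conv ::
    "real measure \<Rightarrow> real measure \<Rightarrow> real measure \<Rightarrow> bool" where
  "is_free_mult_conv \<phi> \<psi> \<mu> \<longleftrightarrow>
     real_distribution \<mu> \<and> symmetric_measure \<mu> \<and> \<mu> \<noteq> return borel 0 \<and>
     (\<forall>w \<in> m_transform \<phi> ` left_half_plane \<inter> m_transform \<psi> ` upper_sector
            \<inter> m_transform \<mu> ` upper_sector.
        S_transform upper_sector \<mu> w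
          = S_transform left_half_plane \<phi> w * S_transform upper_sector \<psi> w)"

end

theory Submission
  imports Defs "HOL-Complex_Analysis.Conformal_Mappings" "HOL-Real_Asymp.Real_Asymp"
begin

text \<open>
  The idea is to describe \<open>\<mu>\<close> through \<open>G(E) = \<integral> 1 / (E - t\<^sup>2) d\<mu>(t)\<close>, the Cauchy transform
  of the image of \<open>\<mu>\<close> under squaring. For \<open>y > 0\<close> the number \<open>w = m\<^sub>\<mu>(iy)\<close> lies in
  \<open>(-1, 0)\<close>, where the inverses of all three moment transforms can be identified. With
  \<open>E = -1/y\<^sup>2\<close> the S-transform identity at \<open>w\<close> says that \<open>G(E) = 1/E + x\<^sup>2\<close> for a real
  solution \<open>x\<close> of the cubic \<open>E x (1 - \<alpha>x) (1 - \<eta>x) = 1 - \<alpha>\<eta>x\<close>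
  (lemma \<open>free_conv_equation_negative\<close>). Eliminating \<open>x\<close> turns this into a polynomial relation between
  \<open>E\<close> and \<open>G(E)\<close>, which by analytic continuation holds off \<open>[0, \<infinity>)\<close> and, by passing to
  boundary values, at those \<open>E > 0\<close> near which \<open>t\<^sup>2\<close> has no mass. So \<open>G\<close> is governed by the
  cubic everywhere.

  Whether \<open>t > 0\<close> belongs to the support can be read off from the real solutions at
  \<open>E = t\<^sup>2\<close>. If the cubic has three distinct real solutions throughout an interval, then \<open>Im G\<close>
  vanishes at the boundary, and the distribution function of \<open>t\<^sup>2\<close> has derivative zero there:
  the interval carries no mass (\<open>not_in_support_if_three_roots\<close>). Conversely,
  on an interval without mass, \<open>E x\<^sup>2 = \<integral> t\<^sup>2 / (E - t\<^sup>2) d\<mu>(t)\<close> is real and decreases in \<open>E\<close>,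
  whereas it would increase if the real solutions were positive and increasing in \<open>E\<close>
  (\<open>in_support_if_branch_decreasing\<close>).

  It remains to count real solutions. In the variable \<open>u = \<alpha>\<eta>x - 1\<close> and with \<open>a = 1 - \<eta>\<close>,
  \<open>b = \<alpha> - 1\<close>, the cubic reads \<open>h(u) = (1 + u) (a + u) (b - u) / u = (\<alpha>\<eta>)\<^sup>2 / E\<close>, and \<open>h\<close> is positive
  only on \<open>(-1, -a)\<close>, where its maximum gives the right end of the support, and on \<open>(0, b)\<close>.
  On \<open>(0, b)\<close> it runs from \<open>\<infinity>\<close> to \<open>0\<close>, either monotonically, and then the support is
  an interval, or with one local minimum and one local maximum, whose levels bound a gap. The second case
  occurs iff \<open>b - 1 - a > 3 (ab)\<^sup>1\<^sup>/\<^sup>3\<close>. With \<open>\<beta>\<^sup>3 = b\<close> and \<open>\<gamma>\<^sup>3 = a\<close> this is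
  \<open>\<beta>\<^sup>3 - 1 - \<gamma>\<^sup>3 - 3\<beta>\<gamma> > 0\<close>, whose left-hand side has the factor \<open>\<beta> - 1 - \<gamma>\<close> and an otherwise
  positive factor; and \<open>\<beta> > 1 + \<gamma>\<close> is the inequality of the theorem.
\<close>

section \<open>Cubics and the level function of the spectral cubic\<close>

text \<open>
  The difference of the two sides is a quadratic polynomial with three distinct zeros.
  The unknown ranges over a general real algebra because the real factorisation is later
  evaluated at complex points.
\<close>

lemma cubic_eq_product_of_roots:
  fixes c3 c2 c1 c0 r1 r2 r3 :: real and u :: "'a :: {real_algebra_1, comm_ring_1}"
  assumes ne: "r1 \<noteq> r2" "r1 \<noteq> r3" "r2 \<noteq> r3"
    and roots: "\<And>r. r \<in> {r1, r2, r3} \<Longrightarrow> c3 * r ^ 3 + c2 * r\<^sup>2 + c1 * r + c0 = 0"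
  shows "of_real c3 * u ^ 3 + of_real c2 * u\<^sup>2 + of_real c1 * u + of_real c0 =
    of_real c3 * (u - of_real r1) * (u - of_real r2) * (u - of_real r3)"
proof -
  define d2 where "d2 = c2 + c3 * (r1 + r2 + r3)"
  define d1 where "d1 = c1 - c3 * (r1 * r2 + r1 * r3 + r2 * r3)"
  define d0 where "d0 = c0 + c3 * (r1 * r2 * r3)"
  have quad: "d2 * r\<^sup>2 + d1 * r + d0 = 0" if "r \<in> {r1, r2, r3}" for r
  proof -
    have "c3 * (r - r1) * (r - r2) * (r - r3) = 0" using that by auto
    then show ?thesis using roots[OF that] unfolding d2_def d1_def d0_def by algebra
  qed
  have "(r1 - r2) * (d2 * (r1 + r2) + d1) = 0"
    using quad[of r1] quad[of r2] by (simp add: algebra_simps power2_eq_square)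
  then have e12: "d2 * (r1 + r2) + d1 = 0" using ne by simp
  have "(r1 - r3) * (d2 * (r1 + r3) + d1) = 0"
    using quad[of r1] quad[of r3] by (simp add: algebra_simps power2_eq_square)
  then have e13: "d2 * (r1 + r3) + d1 = 0" using ne by simp
  have "d2 * (r2 - r3) = (d2 * (r1 + r2) + d1) - (d2 * (r1 + r3) + d1)"
    by (simp only: ring_distribs)
  then have "d2 * (r2 - r3) = 0" using e12 e13 by simp
  then have "d2 = 0" using ne by simp
  then have "d1 = 0" using e12 by simp
  then have "d0 = 0" using quad[of r1] \<open>d2 = 0\<close> by simp
  have eqs: "c2 = - (c3 * (r1 + r2 + r3))" "c1 = c3 * (r1 * r2 + r1 * r3 + r2 * r3)"
    "c0 = - (c3 * (r1 * r2 * r3))"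
    using \<open>d2 = 0\<close> \<open>d1 = 0\<close> \<open>d0 = 0\<close> unfolding d2_def d1_def d0_def by linarith+
  show ?thesis
    unfolding eqs by (simp add: algebra_simps power2_eq_square power3_eq_cube)
qed

lemma cubic_split_by_sign_changes:
  fixes c3 c2 c1 c0 :: real
  defines "f \<equiv> \<lambda>x. c3 * x ^ 3 + c2 * x\<^sup>2 + c1 * x + c0"
  assumes "x0 < x1" "x1 < x2" "x2 < x3"
    and s: "f x0 * f x1 < 0" "f x1 * f x2 < 0" "f x2 * f x3 < 0"
  obtains r1 r2 r3 where "x0 < r1" "r1 < x1" "x1 < r2" "r2 < x2" "x2 < r3" "r3 < x3"
    "\<And>u :: 'a :: {real_algebra_1, comm_ring_1}.
      of_real c3 * u ^ 3 + of_real c2 * u\<^sup>2 + of_real c1 * u + of_real c0 =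
      of_real c3 * (u - of_real r1) * (u - of_real r2) * (u - of_real r3)"
proof -
  have root: "\<exists>r. a < r \<and> r < b \<and> f r = 0" if "a < b" "f a * f b < 0" for a b
  proof -
    have cont: "continuous_on {a..b} f" unfolding f_def by (intro continuous_intros)
    have "f a \<noteq> 0" "f b \<noteq> 0" using that by auto
    note ab = \<open>a < b\<close>
    have opp: "f a < 0 \<and> 0 < f b \<or> f b < 0 \<and> 0 < f a"
      using that(2) by (auto simp: mult_less_0_iff)
    consider "f a \<le> 0" "0 \<le> f b" | "f b \<le> 0" "0 \<le> f a"
      using opp less_imp_le by metis
    then obtain r where r: "a \<le> r" "r \<le> b" "f r = 0"
    proof cases
      case 1 then show ?thesis using IVT'[of f a 0 b] ab cont that by auto
    next
      case 2 then show ?thesis using IVT2'[of f b 0 a] ab cont that by auto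
    qed
    then show ?thesis using \<open>f a \<noteq> 0\<close> \<open>f b \<noteq> 0\<close> by (metis order_le_less)
  qed
  obtain r1 r2 r3 where r: "x0 < r1" "r1 < x1" "x1 < r2" "r2 < x2" "x2 < r3" "r3 < x3"
    "f r1 = 0" "f r2 = 0" "f r3 = 0"
    using root[OF assms(2) s(1)] root[OF assms(3) s(2)] root[OF assms(4) s(3)] by auto
  show ?thesis
    by (rule that[OF r(1-6)], rule cubic_eq_product_of_roots) (use r in \<open>auto simp: f_def\<close>)
qed

text \<open>
  With \<open>a = 1 - \<eta>\<close> and \<open>b = \<alpha> - 1\<close>, the spectral cubic is solved by \<open>x = (1 + u) / (\<alpha>\<eta>)\<close>
  exactly at the level \<open>branch a b u = (\<alpha>\<eta>)\<^sup>2 / E\<close>; small levels belong to large \<open>E\<close>.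
\<close>

definition branch :: "real \<Rightarrow> real \<Rightarrow> real \<Rightarrow> real" where
  "branch a b u = (1 + u) * (a + u) * (b - u) / u"

lemma branch_diff:
  assumes "u \<noteq> 0" "v \<noteq> 0"
  shows "branch a b v - branch a b u = (v - u) * ((b - 1 - a) - a * b / (u * v) - (u + v))"
  unfolding branch_def using assms by (simp add: field_simps)

lemma branch_has_real_derivative:
  assumes "u \<noteq> 0"
  shows "(branch a b has_real_derivative (- 2 * u ^ 3 + (b - 1 - a) * u\<^sup>2 - a * b) / u\<^sup>2) (at u)"
proof -
  have "((\<lambda>u. (1 + u) * (a + u) * (b - u) / u) has_real_derivative
     (- 2 * u ^ 3 + (b - 1 - a) * u\<^sup>2 - a * b) / u\<^sup>2) (at u)"
    using assms by (auto intro!: derivative_eq_intros simp: field_simps power2_eq_square power3_eq_cube)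
  moreover have "branch a b = (\<lambda>u. (1 + u) * (a + u) * (b - u) / u)" by (auto simp: branch_def)
  ultimately show ?thesis by simp
qed

text \<open>
  By the formula for the difference, the claim is \<open>b - 1 - a < ab/(uv) + u + v\<close>. With \<open>m\<close>
  the geometric mean of \<open>u\<close> and \<open>v\<close>, and \<open>\<tau>\<^sup>3 = ab\<close>, this follows from \<open>u + v > 2m\<close> and
  \<open>\<tau>\<^sup>3 + 2m\<^sup>3 \<ge> 3\<tau>m\<^sup>2\<close>. The first inequality is strict, and so the critical case
  \<open>b - 1 - a = 3\<tau>\<close>, where the derivative has a double zero, is included.
\<close>

lemma branch_decreasing:
  assumes ab: "0 < a" "0 < b" and s: "b - 1 - a \<le> 3 * root 3 (a * b)"
    and uv: "0 < u" "u < v"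
  shows "branch a b v < branch a b u"
proof -
  define \<tau> where "\<tau> = root 3 (a * b)"
  define m where "m = sqrt (u * v)"
  have \<tau>: "0 < \<tau>" "\<tau> ^ 3 = a * b" using ab by (auto simp: \<tau>_def)
  have m: "0 < m" "m\<^sup>2 = u * v" using uv by (auto simp: m_def)
  have "0 < (u - v)\<^sup>2" using uv by simp
  also have "(u - v)\<^sup>2 = (u + v)\<^sup>2 - (2 * m)\<^sup>2" using m by (simp add: power2_eq_square algebra_simps)
  finally have "2 * m < u + v"
    using uv power2_less_imp_less[of "2 * m" "u + v"] by simp
  then have "m\<^sup>2 * (2 * m) < m\<^sup>2 * (u + v)" using m(1) by simp
  moreover have "0 \<le> (\<tau> - m)\<^sup>2 * (\<tau> + 2 * m)" using m \<tau> by simp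
  ultimately have "3 * \<tau> * m\<^sup>2 < \<tau> ^ 3 + m\<^sup>2 * (u + v)"
    by (simp add: power2_eq_square power3_eq_cube algebra_simps)
  then have "3 * \<tau> < (\<tau> ^ 3 + m\<^sup>2 * (u + v)) / m\<^sup>2" using m(1) by (simp add: pos_less_divide_eq)
  also have "\<dots> = a * b / (u * v) + (u + v)"
    unfolding \<tau>(2) m(2) using uv by (simp add: add_divide_distrib)
  finally have "(b - 1 - a) - a * b / (u * v) - (u + v) < 0" using s by (simp add: \<tau>_def)
  then have "branch a b v - branch a b u < 0"
    using uv by (subst branch_diff) (auto intro: mult_pos_neg)
  then show ?thesis by simp
qed

text \<open>
  The derivative has the sign of the cubic \<open>-2u\<^sup>3 + (b - 1 - a)u\<^sup>2 - ab\<close>, which is negative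
  at \<open>0\<close> and \<open>b\<close> and, by assumption, positive at \<open>\<tau> = (ab)\<^sup>1\<^sup>/\<^sup>3\<close>; so it has one negative zero
  and two zeros in \<open>(0, b)\<close>. The last conclusion separates the local minimum at \<open>ua\<close> from
  all values on \<open>[-1, -a]\<close>: in \<open>ab/u + (ab + b - a) + (b - 1 - a)u - u\<^sup>2\<close> every term but the
  constant one is negative for negative \<open>u\<close>, while these terms have a positive sum at \<open>ua\<close>.
\<close>

lemma branch_turning_points:
  assumes a: "0 < a" "a < 1" and b: "0 < b" and s: "3 * root 3 (a * b) < b - 1 - a"
  obtains ua ub where "0 < ua" "ua < ub" "ub < b"
    "\<And>u v. 0 < u \<Longrightarrow> u < v \<Longrightarrow> v \<le> ua \<Longrightarrow> branch a b v < branch a b u"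
    "\<And>u v. ua \<le> u \<Longrightarrow> u < v \<Longrightarrow> v \<le> ub \<Longrightarrow> branch a b u < branch a b v"
    "\<And>u v. ub \<le> u \<Longrightarrow> u < v \<Longrightarrow> branch a b v < branch a b u"
    "\<And>u. - 1 \<le> u \<Longrightarrow> u \<le> - a \<Longrightarrow> branch a b u < branch a b ua"
proof -
  define s where "s = b - 1 - a"
  define \<tau> where "\<tau> = root 3 (a * b)"
  define g where "g = (\<lambda>u. (- 2) * u ^ 3 + s * u\<^sup>2 + 0 * u + (- (a * b)))"
  have \<tau>: "0 < \<tau>" "\<tau> ^ 3 = a * b" using a b by (auto simp: \<tau>_def)
  have s\<tau>: "3 * \<tau> < s" using s by (simp add: s_def \<tau>_def)
  have "0 < a * b" using a b by simp
  have "\<tau> < b"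
    using s\<tau> \<tau> a b by (simp add: s_def)
  \<comment> \<open>any point far enough to the left, where \<open>g\<close> is positive\<close>
  define R where "R = 1 + a * b"
  have "1 < R" using \<open>0 < a * b\<close> by (simp add: R_def)
  have "0 < g (- R)"
  proof -
    have "R ^ 3 \<ge> R ^ 1" using \<open>1 < R\<close> by (intro power_increasing) auto
    moreover have "0 \<le> s * R\<^sup>2" using s\<tau> \<tau> by simp
    ultimately show ?thesis using \<open>1 < R\<close> unfolding g_def by (simp add: R_def[symmetric]) (simp add: R_def)
  qed
  moreover have "g 0 < 0" using \<open>0 < a * b\<close> by (simp add: g_def)
  moreover have "0 < g \<tau>"
  proof -
    have "3 * \<tau> * \<tau>\<^sup>2 < s * \<tau>\<^sup>2" using s\<tau> \<tau> by (intro mult_strict_right_mono) auto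
    moreover have "3 * \<tau> * \<tau>\<^sup>2 = 3 * \<tau> ^ 3" by (simp add: power2_eq_square power3_eq_cube)
    ultimately show ?thesis using \<tau>(2) by (simp add: g_def)
  qed
  moreover have "g b < 0"
  proof -
    have "g b = - (b\<^sup>2 * (b + 1 + a)) - a * b"
      by (simp add: g_def s_def algebra_simps power2_eq_square power3_eq_cube)
    moreover have "0 < b\<^sup>2 * (b + 1 + a)" using a b by simp
    ultimately show ?thesis using \<open>0 < a * b\<close> by linarith
  qed
  ultimately have signs: "g (- R) * g 0 < 0" "g 0 * g \<tau> < 0" "g \<tau> * g b < 0"
    by (simp_all add: mult_less_0_iff)
  obtain r ua ub where ord: "- R < r" "r < 0" "0 < ua" "ua < \<tau>" "\<tau> < ub" "ub < b"
    and fac: "\<And>u::real. of_real (- 2) * u ^ 3 + of_real s * u\<^sup>2 + of_real 0 * u + of_real (- (a * b)) =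
       of_real (- 2) * (u - of_real r) * (u - of_real ua) * (u - of_real ub)"
    using \<open>1 < R\<close> \<open>0 < \<tau>\<close> \<open>\<tau> < b\<close>
    by (rule_tac cubic_split_by_sign_changes[OF _ _ _ signs[unfolded g_def], where 'a = real]) auto
  have fac': "- 2 * u ^ 3 + (b - 1 - a) * u\<^sup>2 - a * b = - 2 * ((u - r) * (u - ua) * (u - ub))" for u
    using fac[of u] by (simp add: s_def algebra_simps)
  have deriv: "(branch a b has_real_derivative - 2 * ((u - r) * (u - ua) * (u - ub)) / u\<^sup>2) (at u)"
    if "0 < u" for u
    using branch_has_real_derivative[of u a b] that fac'[of u] by simp
  have cont: "continuous_on {u..v} (branch a b)" if "0 < u" for u v
    by (rule DERIV_continuous_on[where D = "\<lambda>u. - 2 * ((u - r) * (u - ua) * (u - ub)) / u\<^sup>2"])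
      (use that deriv in \<open>auto intro: has_field_derivative_at_within\<close>)
  have dec: "branch a b v < branch a b u"
    if "0 < u" "u < v" "\<And>x. u < x \<Longrightarrow> x < v \<Longrightarrow> 0 < (x - ua) * (x - ub)" for u v
  proof (rule DERIV_neg_imp_decreasing_open[OF \<open>u < v\<close>])
    fix x assume x: "u < x" "x < v"
    have "0 < (x - r) * ((x - ua) * (x - ub))" 
      by (rule mult_pos_pos) (use that(1) that(3)[OF x] x ord in linarith)+
    then have "- 2 * ((x - r) * (x - ua) * (x - ub)) < 0" by (simp add: mult.assoc)
    then have "- 2 * ((x - r) * (x - ua) * (x - ub)) / x\<^sup>2 < 0"
      by (rule divide_neg_pos) (use x that(1) in simp)
    then show "\<exists>y. (branch a b has_real_derivative y) (at x) \<and> y < 0"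
      using deriv[of x] x that by auto
  qed (use cont that in auto)
  have inc: "branch a b u < branch a b v"
    if "0 < u" "u < v" "\<And>x. u < x \<Longrightarrow> x < v \<Longrightarrow> (x - ua) * (x - ub) < 0" for u v
  proof (rule DERIV_pos_imp_increasing_open[OF \<open>u < v\<close>])
    fix x assume x: "u < x" "x < v"
    have "(x - r) * ((x - ua) * (x - ub)) < 0" 
      by (rule mult_pos_neg) (use that(1) that(3)[OF x] x ord in linarith)+
    then have "0 < - 2 * ((x - r) * (x - ua) * (x - ub))" by (simp add: mult.assoc)
    then have "- 2 * ((x - r) * (x - ua) * (x - ub)) / x\<^sup>2 > 0"
      by (rule divide_pos_pos) (use x that(1) in simp)
    then show "\<exists>y. (branch a b has_real_derivative y) (at x) \<and> 0 < y"
      using deriv[of x] x that by auto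
  qed (use cont that in auto)
  have neg: "branch a b u < branch a b ua" if "- 1 \<le> u" "u \<le> - a" for u
  proof -
    have "u < 0" using that a by simp
    have crit: "s * ua\<^sup>2 = 2 * ua ^ 3 + a * b" using fac'[of ua] by (simp add: s_def)
    have "branch a b v = a * b / v + (a * b + b - a) + s * v - v\<^sup>2" if "v \<noteq> 0" for v
      using that by (simp add: branch_def s_def field_simps power2_eq_square)
    note exp = this[of u] this[of ua]
    have "s * u < 0" using s\<tau> \<tau> \<open>u < 0\<close> by (simp add: mult_less_0_iff)
    moreover have "a * b / u < 0" using \<open>u < 0\<close> \<open>0 < a * b\<close> by (simp add: divide_less_0_iff)
    moreover have "0 \<le> u\<^sup>2" by simp
    ultimately have "branch a b u < a * b + b - a" using exp(1) \<open>u < 0\<close> by linarith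
    moreover have "s * ua = 2 * ua\<^sup>2 + a * b / ua"
      using crit ord by (simp add: field_simps power2_eq_square power3_eq_cube)
    moreover have "0 < a * b / ua" using ord \<open>0 < a * b\<close> by simp
    moreover have "0 \<le> ua\<^sup>2" by simp
    ultimately show ?thesis using exp(2) ord by linarith
  qed
  show ?thesis
  proof (rule that[of ua ub])
    show "branch a b v < branch a b u" if "0 < u" "u < v" "v \<le> ua" for u v
      using that ord by (intro dec) (auto intro: mult_neg_neg)
    show "branch a b u < branch a b v" if "ua \<le> u" "u < v" "v \<le> ub" for u v
      using that ord by (intro inc) (auto intro: mult_pos_neg)
    show "branch a b v < branch a b u" if "ub \<le> u" "u < v" for u v
      using that ord by (intro dec) auto
  qed (use ord neg in auto)
qed

lemma branch_max_left:
  assumes a: "0 < a" "a < 1" and b: "0 < b"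
  obtains u0 where "- 1 < u0" "u0 < - a" "0 < branch a b u0"
    "\<And>u. - 1 \<le> u \<Longrightarrow> u \<le> - a \<Longrightarrow> branch a b u \<le> branch a b u0"
proof -
  have "continuous_on {- 1..- a} (branch a b)"
    unfolding branch_def using a by (intro continuous_intros) auto
  then obtain u0 where u0: "u0 \<in> {- 1..- a}" "\<And>u. u \<in> {- 1..- a} \<Longrightarrow> branch a b u \<le> branch a b u0"
    using continuous_attains_sup[of "{- 1..- a}" "branch a b"] a by auto
  define v where "v = (- 1 - a) / 2"
  have v: "- 1 < v" "v < - a" using a by (auto simp: v_def field_simps)
  have "(1 + v) * (a + v) * (b - v) < 0"
    using v a b by (intro mult_neg_pos mult_pos_neg) auto
  then have "0 < branch a b v"
    unfolding branch_def using v a by (intro divide_neg_neg) auto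
  also have "branch a b v \<le> branch a b u0" using v by (intro u0) auto
  finally have pos: "0 < branch a b u0" .
  then have "u0 \<noteq> - 1" "u0 \<noteq> - a" by (auto simp: branch_def)
  then show ?thesis using that[of u0] u0 pos by force
qed

text \<open>
  Let \<open>\<gamma>\<^sup>3 = 1 - \<eta>\<close> and \<open>\<beta>\<^sup>3 = \<alpha> - 1\<close>. Since \<open>\<eta> = (1 - \<gamma>)(1 + \<gamma> + \<gamma>\<^sup>2)\<close>, the left side says
  \<open>\<beta>\<^sup>3 > (1 + \<gamma>)\<^sup>3\<close>. The right side says \<open>p\<^sup>3 + q\<^sup>3 + r\<^sup>3 - 3pqr > 0\<close> for
  \<open>p = \<beta>\<close>, \<open>q = -1\<close>, \<open>r = -\<gamma>\<close>, an expression divisible by \<open>p + q + r\<close>.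
\<close>

lemma gap_condition_iff:
  fixes \<alpha> \<eta> :: real
  assumes \<eta>: "0 < \<eta>" "\<eta> < 1" and \<alpha>: "1 < \<alpha>"
  shows "\<eta> * (3 / (1 - root 3 (1 - \<eta>)) - 1) < \<alpha> \<longleftrightarrow>
    3 * root 3 ((1 - \<eta>) * (\<alpha> - 1)) < (\<alpha> - 1) - 1 - (1 - \<eta>)"
proof -
  define \<gamma> where "\<gamma> = root 3 (1 - \<eta>)"
  define \<beta> where "\<beta> = root 3 (\<alpha> - 1)"
  have \<gamma>: "0 < \<gamma>" "\<gamma> < 1" "\<eta> = 1 - \<gamma> ^ 3" using \<eta> by (auto simp: \<gamma>_def)
  have \<beta>: "0 < \<beta>" "\<alpha> = 1 + \<beta> ^ 3" using \<alpha> by (auto simp: \<beta>_def)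
  have "\<eta> * (3 / (1 - \<gamma>) - 1) = 1 + (1 + \<gamma>) ^ 3"
    unfolding \<gamma>(3) using \<gamma>(1,2) by (simp add: divide_simps) (simp add: power3_eq_cube algebra_simps)
  then have "\<eta> * (3 / (1 - \<gamma>) - 1) < \<alpha> \<longleftrightarrow> (1 + \<gamma>) ^ 3 < \<beta> ^ 3" using \<beta> by simp
  also have "\<dots> \<longleftrightarrow> 0 < \<beta> - 1 - \<gamma>"
    using \<beta> \<gamma> power_less_imp_less_base[of "1 + \<gamma>" 3 \<beta>] power_strict_mono[of "1 + \<gamma>" \<beta> 3]
    by (metis add_pos_pos diff_diff_eq diff_gt_0_iff_gt less_imp_le zero_less_one zero_less_numeral)
  also have "\<dots> \<longleftrightarrow> 0 < (\<beta> - 1 - \<gamma>) * (\<beta>\<^sup>2 + \<beta> + \<beta> * \<gamma> + (1 - \<gamma> + \<gamma>\<^sup>2))"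
  proof -
    have "0 < \<beta>\<^sup>2 + \<beta> + \<beta> * \<gamma> + (1 - \<gamma> + \<gamma>\<^sup>2)"
      using \<beta> \<gamma> by (intro add_pos_pos) auto
    then show ?thesis by (simp add: zero_less_mult_iff)
  qed
  also have "(\<beta> - 1 - \<gamma>) * (\<beta>\<^sup>2 + \<beta> + \<beta> * \<gamma> + (1 - \<gamma> + \<gamma>\<^sup>2)) = \<beta> ^ 3 - 1 - \<gamma> ^ 3 - 3 * (\<gamma> * \<beta>)"
    by (simp add: algebra_simps power2_eq_square power3_eq_cube)
  also have "\<gamma> * \<beta> = root 3 ((1 - \<eta>) * (\<alpha> - 1))"
    by (simp add: \<gamma>_def \<beta>_def real_root_mult)
  also have "\<beta> ^ 3 - 1 - \<gamma> ^ 3 - 3 * root 3 ((1 - \<eta>) * (\<alpha> - 1)) =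
      (\<alpha> - 1) - 1 - (1 - \<eta>) - 3 * root 3 ((1 - \<eta>) * (\<alpha> - 1))"
    using \<beta>(2) \<gamma>(3) by simp
  finally show ?thesis unfolding \<gamma>_def by simp
qed

section \<open>Moment transforms of symmetric measures\<close>

lemma integral_two_atoms:
  fixes f :: "real \<Rightarrow> 'b :: {banach, second_countable_topology}"
  assumes "real_distribution M" and "x \<noteq> y" and full: "measure M {x, y} = 1"
    and f: "f \<in> borel_measurable borel"
  shows "integral\<^sup>L M f = measure M {x} *\<^sub>R f x + measure M {y} *\<^sub>R f y"
proof -
  interpret real_distribution M by fact
  have [measurable]: "f \<in> borel_measurable M" using f by simp
  have ind: "integrable M (indicat_real {v})" for v
    by (intro integrable_real_indicator) (auto simp: emeasure_eq_measure)
  then have int: "integrable M (\<lambda>t. indicator {v} t *\<^sub>R f v)" for v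
    by (intro integrable_scaleR_left)
  have "AE t in M. t \<in> {x, y}" using full by (subst prob_eq_1[symmetric]) auto
  then have "AE t in M. f t = indicator {x} t *\<^sub>R f x + indicator {y} t *\<^sub>R f y"
    by (rule AE_mp) (use \<open>x \<noteq> y\<close> in auto)
  then have "integral\<^sup>L M f = (\<integral>t. indicator {x} t *\<^sub>R f x + indicator {y} t *\<^sub>R f y \<partial>M)"
    by (intro integral_cong_AE) auto
  also have "\<dots> = measure M {x} *\<^sub>R f x + measure M {y} *\<^sub>R f y"
    by (subst Bochner_Integration.integral_add[OF int int])
      (simp add: integral_scaleR_left[OF ind])
  finally show ?thesis .
qed

lemma integral_odd_symmetric:
  fixes f :: "real \<Rightarrow> 'b :: {banach, second_countable_topology}"
  assumes sym: "symmetric_measure M" and [measurable_cong]: "sets M = sets borel"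
    and f [measurable]: "f \<in> borel_measurable borel" and odd: "\<And>t. f (- t) = - f t"
  shows "integral\<^sup>L M f = 0"
proof -
  have "integral\<^sup>L M f = integral\<^sup>L (distr M borel uminus) f"
    using sym by (simp add: symmetric_measure_def)
  also have "\<dots> = (\<integral>t. f (- t) \<partial>M)"
    by (rule integral_distr) measurable
  also have "\<dots> = - integral\<^sup>L M f" by (simp add: odd)
  finally have "2 *\<^sub>R integral\<^sup>L M f = 0"
    by (metis add.right_inverse scaleR_2)
  then show ?thesis by simp
qed

text \<open>
  The sector consists of the \<open>z\<close> in the upper half-plane with \<open>Re (z\<^sup>2) < 0\<close>; here
  \<open>c = - Re (z\<^sup>2)\<close>.
\<close>

lemma upper_sector_bound:
  assumes "z \<in> upper_sector"
  obtains c where "0 < c" "\<And>t. Re (1 - z\<^sup>2 * (complex_of_real t)\<^sup>2) = 1 + c * t\<^sup>2"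
    "\<And>t. 1 + c * t\<^sup>2 \<le> norm (1 - z\<^sup>2 * (complex_of_real t)\<^sup>2)"
proof -
  define c where "c = (Im z)\<^sup>2 - (Re z)\<^sup>2"
  have "\<bar>Re z\<bar> < Im z" using assms by (simp add: upper_sector_def)
  then have "\<bar>Re z\<bar>\<^sup>2 < (Im z)\<^sup>2" by (intro power_strict_mono) auto
  then have "0 < c" by (simp add: c_def)
  have re: "Re (1 - z\<^sup>2 * (complex_of_real t)\<^sup>2) = 1 + c * t\<^sup>2" for t
    by (simp add: c_def power2_eq_square algebra_simps)
  moreover have "1 + c * t\<^sup>2 \<le> norm (1 - z\<^sup>2 * (complex_of_real t)\<^sup>2)" for t
    by (metis re complex_Re_le_cmod)
  ultimately show ?thesis using that \<open>0 < c\<close> by blast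
qed

lemma upper_sector_denominator_nonzero:
  assumes "z \<in> upper_sector"
  shows "1 - z\<^sup>2 * (complex_of_real t)\<^sup>2 \<noteq> 0"
proof -
  obtain c where c: "0 < c" "\<And>t. 1 + c * t\<^sup>2 \<le> norm (1 - z\<^sup>2 * (complex_of_real t)\<^sup>2)"
    using upper_sector_bound[OF assms] by metis
  have "0 < 1 + c * t\<^sup>2" using c(1) by (simp add: add_pos_nonneg)
  then show ?thesis using c(2)[of t] by auto
qed

lemma imaginary_in_upper_sector [simp]: "0 < y \<Longrightarrow> \<i> * complex_of_real y \<in> upper_sector"
  by (simp add: upper_sector_def)

lemma integrable_even_part:
  assumes "finite_measure M" and [simp, measurable_cong]: "sets M = sets borel" and z: "z \<in> upper_sector"
  shows "integrable M (\<lambda>t. z\<^sup>2 * (complex_of_real t)\<^sup>2 / (1 - z\<^sup>2 * (complex_of_real t)\<^sup>2))"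
proof -
  obtain c where c: "0 < c" "\<And>t. 1 + c * t\<^sup>2 \<le> norm (1 - z\<^sup>2 * (complex_of_real t)\<^sup>2)"
    using upper_sector_bound[OF z] by metis
  have "norm (z\<^sup>2 * (complex_of_real t)\<^sup>2 / (1 - z\<^sup>2 * (complex_of_real t)\<^sup>2)) \<le> (norm z)\<^sup>2 / c" for t
  proof -
    have "0 < 1 + c * t\<^sup>2" using c(1) by (simp add: add_pos_nonneg)
    have "norm (z\<^sup>2 * (complex_of_real t)\<^sup>2 / (1 - z\<^sup>2 * (complex_of_real t)\<^sup>2)) =
        (norm z)\<^sup>2 * t\<^sup>2 / norm (1 - z\<^sup>2 * (complex_of_real t)\<^sup>2)"
      by (simp add: norm_mult norm_divide norm_power)
    also have "\<dots> \<le> (norm z)\<^sup>2 * t\<^sup>2 / (1 + c * t\<^sup>2)"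
      using c(2)[of t] \<open>0 < 1 + c * t\<^sup>2\<close>
      by (intro divide_left_mono mult_pos_pos less_le_trans[OF \<open>0 < 1 + c * t\<^sup>2\<close> c(2)]) auto
    also have "\<dots> \<le> (norm z)\<^sup>2 / c"
      using c(1) \<open>0 < 1 + c * t\<^sup>2\<close> by (simp add: field_simps)
    finally show ?thesis .
  qed
  then show ?thesis
    by (intro finite_measure.integrable_const_bound[OF assms(1), where B = "(norm z)\<^sup>2 / c"]) auto
qed

text \<open>
  Multiplying numerator and denominator by \<open>1 + zt\<close> splits the integrand into an odd part,
  whose integral vanishes, and an even part.
\<close>

lemma m_transform_symmetric:
  assumes fin: "finite_measure M" and [simp, measurable_cong]: "sets M = sets borel"
    and sym: "symmetric_measure M" and z: "z \<in> upper_sector"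
  shows "m_transform M z =
    (\<integral>t. z\<^sup>2 * (complex_of_real t)\<^sup>2 / (1 - z\<^sup>2 * (complex_of_real t)\<^sup>2) \<partial>M)"
proof -
  let ?even = "\<lambda>t. z\<^sup>2 * (complex_of_real t)\<^sup>2 / (1 - z\<^sup>2 * (complex_of_real t)\<^sup>2)"
  let ?odd = "\<lambda>t. z * complex_of_real t / (1 - z\<^sup>2 * (complex_of_real t)\<^sup>2)"
  obtain c where c: "0 < c" "\<And>t. 1 + c * t\<^sup>2 \<le> norm (1 - z\<^sup>2 * (complex_of_real t)\<^sup>2)"
    using upper_sector_bound[OF z] by metis
  have "norm (?odd t) \<le> norm z * (1 + 1 / c)" for t
  proof -
    have pos: "0 < 1 + c * t\<^sup>2" using c(1) by (simp add: add_pos_nonneg)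
    have "0 \<le> (\<bar>t\<bar> - 1)\<^sup>2" by simp
    then have "\<bar>t\<bar> \<le> 1 + t\<^sup>2" by (simp add: power2_eq_square algebra_simps abs_mult_self_eq)
    also have "\<dots> \<le> (1 + 1 / c) * (1 + c * t\<^sup>2)" using c(1) by (simp add: field_simps)
    finally have "\<bar>t\<bar> / (1 + c * t\<^sup>2) \<le> 1 + 1 / c" using pos by (simp add: pos_divide_le_eq)
    have "norm (?odd t) = norm z * \<bar>t\<bar> / norm (1 - z\<^sup>2 * (complex_of_real t)\<^sup>2)"
      by (simp add: norm_mult norm_divide norm_power)
    also have "\<dots> \<le> norm z * \<bar>t\<bar> / (1 + c * t\<^sup>2)"
      using c(2)[of t] pos
      by (intro divide_left_mono mult_pos_pos less_le_trans[OF pos c(2)]) auto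
    also have "\<dots> = norm z * (\<bar>t\<bar> / (1 + c * t\<^sup>2))" by simp
    also have "\<dots> \<le> norm z * (1 + 1 / c)"
      using \<open>\<bar>t\<bar> / (1 + c * t\<^sup>2) \<le> 1 + 1 / c\<close> by (intro mult_left_mono) auto
    finally show ?thesis .
  qed
  then have int_odd: "integrable M ?odd"
    by (intro finite_measure.integrable_const_bound[OF fin, where B = "norm z * (1 + 1 / c)"]) auto
  have "z * complex_of_real t / (1 - z * complex_of_real t) = ?odd t + ?even t" for t
  proof -
    have fac: "1 - z\<^sup>2 * (complex_of_real t)\<^sup>2 = (1 - z * complex_of_real t) * (1 + z * complex_of_real t)"
      by (simp add: algebra_simps power2_eq_square)
    have "1 + z * complex_of_real t \<noteq> 0"
      using upper_sector_denominator_nonzero[OF z, of t] unfolding fac by auto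
    have "?odd t + ?even t = (z * complex_of_real t * (1 + z * complex_of_real t)) /
        ((1 - z * complex_of_real t) * (1 + z * complex_of_real t))"
      unfolding fac by (simp add: add_divide_distrib algebra_simps power2_eq_square)
    also have "\<dots> = z * complex_of_real t / (1 - z * complex_of_real t)"
      using \<open>1 + z * complex_of_real t \<noteq> 0\<close> by simp
    finally show ?thesis by simp
  qed
  then have "m_transform M z = integral\<^sup>L M ?odd + integral\<^sup>L M ?even"
    unfolding m_transform_def using int_odd integrable_even_part[OF fin _ z] by simp
  moreover have "integral\<^sup>L M ?odd = 0"
    by (rule integral_odd_symmetric[OF sym]) auto
  ultimately show ?thesis by simp
qed

lemma m_transform_imaginary:
  assumes fin: "finite_measure M" and [simp, measurable_cong]: "sets M = sets borel"
    and sym: "symmetric_measure M" and y: "0 < y"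
  shows "m_transform M (\<i> * complex_of_real y) = - complex_of_real (\<integral>t. y\<^sup>2 * t\<^sup>2 / (1 + y\<^sup>2 * t\<^sup>2) \<partial>M)"
proof -
  have "m_transform M (\<i> * complex_of_real y) = (\<integral>t. complex_of_real (- (y\<^sup>2 * t\<^sup>2 / (1 + y\<^sup>2 * t\<^sup>2))) \<partial>M)"
    by (subst m_transform_symmetric[OF fin _ sym]) (use y in \<open>auto simp: power_mult_distrib\<close>)
  then show ?thesis by (subst (asm) integral_complex_of_real) simp
qed

lemma integral_pos_if_not_AE_zero:
  fixes f :: "real \<Rightarrow> real"
  assumes "integrable M f" "\<And>t. 0 \<le> f t" "\<And>t. f t = 0 \<Longrightarrow> t = 0" "\<not> (AE t in M. t = 0)"
  shows "0 < integral\<^sup>L M f"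
proof -
  have "integral\<^sup>L M f \<noteq> 0"
  proof
    assume "integral\<^sup>L M f = 0"
    then have "AE t in M. f t = 0"
      using assms(1,2) by (subst (asm) integral_nonneg_eq_0_iff_AE) auto
    then have "AE t in M. t = 0" by eventually_elim (rule assms(3))
    then show False using assms(4) by simp
  qed
  moreover have "0 \<le> integral\<^sup>L M f" using assms(2) by (intro Bochner_Integration.integral_nonneg) auto
  ultimately show ?thesis by simp
qed

text \<open>
  The difference of the two values is \<open>z\<^sup>2 + y\<^sup>2\<close> times the integral of
  \<open>t\<^sup>2 / ((1 - z\<^sup>2t\<^sup>2)(1 + y\<^sup>2t\<^sup>2))\<close>, and in the sector this integrand has nonnegative real
  part. This identifies the inverse of the moment transform at all real values that it takes on
  the imaginary axis.
\<close>

lemma m_transform_eq_imaginary_imp_eq: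
  assumes fin: "finite_measure M" and [simp, measurable_cong]: "sets M = sets borel"
    and sym: "symmetric_measure M" and nz: "\<not> (AE t in M. t = 0)"
    and z: "z \<in> upper_sector" and y: "0 < y"
    and eq: "m_transform M z = m_transform M (\<i> * complex_of_real y)"
  shows "z = \<i> * complex_of_real y"
proof -
  let ?w = "\<i> * complex_of_real y"
  have w: "?w \<in> upper_sector" using y by simp
  define J where "J = (\<lambda>t. (complex_of_real t)\<^sup>2 /
    ((1 - z\<^sup>2 * (complex_of_real t)\<^sup>2) * (1 - ?w\<^sup>2 * (complex_of_real t)\<^sup>2)))"
  obtain c where c: "0 < c" "\<And>t. Re (1 - z\<^sup>2 * (complex_of_real t)\<^sup>2) = 1 + c * t\<^sup>2"
    "\<And>t. 1 + c * t\<^sup>2 \<le> norm (1 - z\<^sup>2 * (complex_of_real t)\<^sup>2)"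
    using upper_sector_bound[OF z] by metis
  have pos: "0 < 1 + c * t\<^sup>2" for t using c(1) by (simp add: add_pos_nonneg)
  have posy: "0 < 1 + y\<^sup>2 * t\<^sup>2" for t by (simp add: add_pos_nonneg)
  have Jw: "J t = complex_of_real (t\<^sup>2 / (1 + y\<^sup>2 * t\<^sup>2)) / (1 - z\<^sup>2 * (complex_of_real t)\<^sup>2)" for t
  proof -
    have "1 - ?w\<^sup>2 * (complex_of_real t)\<^sup>2 = complex_of_real (1 + y\<^sup>2 * t\<^sup>2)"
      by (simp add: power_mult_distrib)
    then show ?thesis by (simp only: J_def) (simp add: divide_divide_eq_left mult.commute)
  qed
  have "norm (J t) \<le> 1 / y\<^sup>2" for t
  proof -
    have "norm (J t) = (t\<^sup>2 / (1 + y\<^sup>2 * t\<^sup>2)) / norm (1 - z\<^sup>2 * (complex_of_real t)\<^sup>2)"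
      unfolding Jw norm_divide norm_of_real using posy[of t] by simp
    also have "\<dots> \<le> (t\<^sup>2 / (1 + y\<^sup>2 * t\<^sup>2)) / 1"
    proof (rule divide_left_mono)
      have "0 \<le> c * t\<^sup>2" using c(1) by simp
      then show "1 \<le> norm (1 - z\<^sup>2 * (complex_of_real t)\<^sup>2)" using c(3)[of t] by linarith
      then show "0 < norm (1 - z\<^sup>2 * (complex_of_real t)\<^sup>2) * 1" by linarith
    qed (use posy[of t] in simp)
    also have "\<dots> \<le> 1 / y\<^sup>2" using posy[of t] y by (simp add: field_simps)
    finally show ?thesis .
  qed
  then have intJ: "integrable M J"
    unfolding J_def
    by (intro finite_measure.integrable_const_bound[OF fin, where B = "1 / y\<^sup>2"]) auto
  have "0 < (\<integral>t. Re (J t) \<partial>M)"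
  proof (rule integral_pos_if_not_AE_zero[OF _ _ _ nz])
    have ReJ: "Re (J t) = (t\<^sup>2 / (1 + y\<^sup>2 * t\<^sup>2)) * ((1 + c * t\<^sup>2) / (norm (1 - z\<^sup>2 * (complex_of_real t)\<^sup>2))\<^sup>2)" for t
      unfolding Jw by (simp only: Re_divide' Re_complex_of_real Im_complex_of_real c(2) mult_zero_left) simp
    show "0 \<le> Re (J t)" for t unfolding ReJ using pos[of t] posy[of t] by simp
    show "t = 0" if "Re (J t) = 0" for t
      using that pos[of t] posy[of t] upper_sector_denominator_nonzero[OF z, of t] unfolding ReJ by auto
    show "integrable M (\<lambda>t. Re (J t))" using intJ by simp
  qed
  then have "integral\<^sup>L M J \<noteq> 0" using intJ by (subst (asm) integral_Re) auto
  have "z\<^sup>2 * (complex_of_real t)\<^sup>2 / (1 - z\<^sup>2 * (complex_of_real t)\<^sup>2) -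
      ?w\<^sup>2 * (complex_of_real t)\<^sup>2 / (1 - ?w\<^sup>2 * (complex_of_real t)\<^sup>2) = (z\<^sup>2 - ?w\<^sup>2) * J t" for t
  proof -
    have gen: "a * s / A - b * s / B = (a - b) * (s / (A * B))"
      if "A = 1 - a * s" "B = 1 - b * s" "A \<noteq> 0" "B \<noteq> 0" for a b s A B :: complex
    proof -
      have "a * s / A - b * s / B = (a * s * B - b * s * A) / (A * B)" using that by (simp add: diff_frac_eq)
      also have "a * s * B - b * s * A = (a - b) * s" unfolding that(1,2) by (simp add: algebra_simps)
      finally show ?thesis by simp
    qed
    show ?thesis unfolding J_def
      by (rule gen) (use upper_sector_denominator_nonzero[OF z, of t]
          upper_sector_denominator_nonzero[OF w, of t] in auto)
  qed
  then have "m_transform M z - m_transform M ?w = (z\<^sup>2 - ?w\<^sup>2) * integral\<^sup>L M J"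
    using integrable_even_part[OF fin _ z] integrable_even_part[OF fin _ w]
    by (simp only: m_transform_symmetric[OF fin _ sym z] m_transform_symmetric[OF fin _ sym w]
        Bochner_Integration.integral_diff[symmetric] integral_mult_right_zero assms(2))
  then have "z\<^sup>2 = ?w\<^sup>2" using eq \<open>integral\<^sup>L M J \<noteq> 0\<close> by simp
  then have "z = ?w \<or> z = - ?w" by (simp add: power2_eq_iff)
  moreover have "z \<noteq> - ?w" using z y by (auto simp: upper_sector_def)
  ultimately show ?thesis by simp
qed

lemma inv_into_m_transform_imaginary:
  assumes fin: "finite_measure M" and sets: "sets M = sets borel"
    and sym: "symmetric_measure M" and nz: "\<not> (AE t in M. t = 0)" and y: "0 < y"
  shows "inv_into upper_sector (m_transform M) (m_transform M (\<i> * complex_of_real y)) = \<i> * complex_of_real y"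
proof -
  have im: "m_transform M (\<i> * complex_of_real y) \<in> m_transform M ` upper_sector"
    by (intro imageI) (use y in simp)
  show ?thesis
    by (rule m_transform_eq_imaginary_imp_eq[OF fin sets sym nz inv_into_into[OF im] y f_inv_into_f[OF im]])
qed

section \<open>The semicircle law\<close>

lemma semicircle_sets [simp, measurable_cong]: "sets standard_semicircle = sets borel"
  by (simp add: standard_semicircle_def)

lemma finite_measure_semicircle: "finite_measure standard_semicircle"
proof
  have bound: "ennreal (indicator {- 2..2} x * sqrt (4 - x\<^sup>2) / (2 * pi)) \<le> indicator {- 2..2} x" for x :: real
  proof (cases "x \<in> {- 2..2}")
    case True
    have "sqrt (4 - x\<^sup>2) \<le> sqrt (2\<^sup>2)" by (rule real_sqrt_le_mono) simp
    then have "sqrt (4 - x\<^sup>2) / (2 * pi) \<le> 1" using pi_gt3 by simp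
    then show ?thesis using True by simp
  qed simp
  have "emeasure standard_semicircle (space standard_semicircle) =
      (\<integral>\<^sup>+ x. ennreal (indicator {- 2..2} x * sqrt (4 - x\<^sup>2) / (2 * pi)) \<partial>lborel)"
    unfolding standard_semicircle_def by (subst emeasure_density) auto
  also have "\<dots> \<le> (\<integral>\<^sup>+ x. indicator {- 2..2 :: real} x \<partial>lborel)"
    by (intro nn_integral_mono bound)
  also have "\<dots> < \<infinity>" by simp
  finally show "emeasure standard_semicircle (space standard_semicircle) \<noteq> \<infinity>" by simp
qed

lemma symmetric_semicircle: "symmetric_measure standard_semicircle"
proof -
  let ?g = "\<lambda>x :: real. ennreal (indicator {- 2..2} x * sqrt (4 - x\<^sup>2) / (2 * pi))"
  have "(\<lambda>x. ?g (- x)) = ?g" by (auto simp: indicator_def fun_eq_iff)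
  moreover have "density (distr lborel borel uminus) ?g = distr (density lborel (\<lambda>x. ?g (- x))) borel uminus"
    by (rule density_distr) auto
  ultimately show ?thesis
    by (simp add: symmetric_measure_def standard_semicircle_def lborel_distr_uminus)
qed

text \<open>
  Under \<open>t = 2 sin \<theta>\<close> the function is \<open>arctan (k tan \<theta>)\<close>.
\<close>

lemma DERIV_arctan_ratio:
  fixes k t :: real
  assumes "- 2 < t" "t < 2"
  shows "((\<lambda>t. arctan (k * t / sqrt (4 - t\<^sup>2))) has_real_derivative
    4 * k / (sqrt (4 - t\<^sup>2) * (4 - t\<^sup>2 + k\<^sup>2 * t\<^sup>2))) (at t)"
proof -
  define r where "r = sqrt (4 - t\<^sup>2)"
  have "\<bar>t\<bar>\<^sup>2 < 2\<^sup>2" using assms by (intro power_strict_mono) auto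
  then have r2: "0 < 4 - t\<^sup>2" by simp
  then have r: "0 < r" "r\<^sup>2 = 4 - t\<^sup>2" by (auto simp: r_def)
  have dr: "((\<lambda>t. sqrt (4 - t\<^sup>2)) has_real_derivative - t / r) (at t)"
    unfolding r_def using r2 by (auto intro!: derivative_eq_intros simp: field_simps)
  have "((\<lambda>t. k * t / sqrt (4 - t\<^sup>2)) has_real_derivative 4 * k / (r * r\<^sup>2)) (at t)"
  proof -
    have "((\<lambda>t. k * t / sqrt (4 - t\<^sup>2)) has_real_derivative (k * r - k * t * (- t / r)) / (r * r)) (at t)"
      using r unfolding r_def
      by (intro DERIV_divide dr[unfolded r_def]) (auto intro!: derivative_eq_intros)
    moreover have "(k * r - k * t * (- t / r)) / (r * r) = 4 * k / (r * r\<^sup>2)"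
    proof -
      have "k * r - k * t * (- t / r) = k * (r\<^sup>2 + t\<^sup>2) / r"
        using r(1) by (simp add: field_simps power2_eq_square)
      also have "r\<^sup>2 + t\<^sup>2 = 4" using r(2) by simp
      finally show ?thesis using r(1) by (simp add: power2_eq_square)
    qed
    ultimately show ?thesis by simp
  qed
  then have "((\<lambda>t. arctan (k * t / sqrt (4 - t\<^sup>2))) has_real_derivative
      inverse (1 + (k * t / r)\<^sup>2) * (4 * k / (r * r\<^sup>2))) (at t)"
    unfolding r_def[symmetric] using DERIV_chain2[OF DERIV_arctan] by (fastforce simp: r_def)
  also have "inverse (1 + (k * t / r)\<^sup>2) * (4 * k / (r * r\<^sup>2)) = 4 * k / (r * (r\<^sup>2 + k\<^sup>2 * t\<^sup>2))"
  proof -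
    have "1 + (k * t / r)\<^sup>2 = (r\<^sup>2 + k\<^sup>2 * t\<^sup>2) / r\<^sup>2"
      using r(1) by (simp add: power_mult_distrib power_divide add_divide_distrib)
    then show ?thesis using r(1) by simp
  qed
  finally show ?thesis unfolding r(2) by (simp add: r_def)
qed

text \<open>
  The antiderivative comes from the substitution \<open>t = 2 sin \<theta>\<close>. Its summand \<open>A 1\<close> is
  \<open>arcsin (t/2)\<close>, written so that all limits at the end points are limits of the arctangent.
\<close>

lemma semicircle_integral:
  fixes y k :: real
  assumes y: "0 < y" and k: "0 < k" "k\<^sup>2 = 1 + 4 * y\<^sup>2"
  shows "(\<integral>t. y\<^sup>2 * t\<^sup>2 / (1 + y\<^sup>2 * t\<^sup>2) \<partial>standard_semicircle) = 1 - (k - 1) / (2 * y\<^sup>2)"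
proof -
  let ?r = "\<lambda>t :: real. sqrt (4 - t\<^sup>2)"
  define f where "f = (\<lambda>t :: real. y\<^sup>2 * t\<^sup>2 / (1 + y\<^sup>2 * t\<^sup>2) * ?r t)"
  define A where "A = (\<lambda>l t :: real. arctan (l * t / ?r t))"
  define F where "F = (\<lambda>t. t * ?r t / 2 + 2 * A 1 t - (k * A k t - A 1 t) / y\<^sup>2)"
  have pos: "0 < 1 + y\<^sup>2 * t\<^sup>2" for t by (simp add: add_pos_nonneg)
  have dF: "(F has_real_derivative f t) (at t)" if t: "- 2 < t" "t < 2" for t
  proof -
    define r where "r = ?r t"
    have "\<bar>t\<bar>\<^sup>2 < 2\<^sup>2" using t by (intro power_strict_mono) auto
    then have r2: "0 < 4 - t\<^sup>2" by simp
    then have r: "0 < r" "r\<^sup>2 = 4 - t\<^sup>2" by (auto simp: r_def)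
    have d1: "(A 1 has_real_derivative 1 / r) (at t)"
      using DERIV_arctan_ratio[OF t, of 1] by (simp add: A_def r_def)
    have dk: "(A k has_real_derivative k / (r * (1 + y\<^sup>2 * t\<^sup>2))) (at t)"
    proof -
      have eq: "4 - t\<^sup>2 + k\<^sup>2 * t\<^sup>2 = 4 * (1 + y\<^sup>2 * t\<^sup>2)"
        unfolding k(2) by (simp add: algebra_simps)
      have "4 * k / (r * (4 * (1 + y\<^sup>2 * t\<^sup>2))) = k / (r * (1 + y\<^sup>2 * t\<^sup>2))"
        by (simp only: mult.left_commute[of r 4] mult_divide_mult_cancel_left)
      then show ?thesis
        using DERIV_arctan_ratio[OF t, of k] unfolding A_def eq r_def[symmetric] by simp
    qed
    have dr: "((\<lambda>t. t * ?r t / 2) has_real_derivative (r + t * (- t / r)) / 2) (at t)"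
      unfolding r_def using r2 by (auto intro!: derivative_eq_intros simp: field_simps)
    have "(F has_real_derivative (r + t * (- t / r)) / 2 + 2 * (1 / r) -
        (k * (k / (r * (1 + y\<^sup>2 * t\<^sup>2))) - 1 / r) / y\<^sup>2) (at t)"
      unfolding F_def
      by (intro DERIV_diff DERIV_add dr DERIV_cmult DERIV_cdivide d1 dk)
    also have "(r + t * (- t / r)) / 2 + 2 * (1 / r) -
        (k * (k / (r * (1 + y\<^sup>2 * t\<^sup>2))) - 1 / r) / y\<^sup>2 = f t"
    proof -
      have 1: "(r + t * (- t / r)) / 2 + 2 * (1 / r) = (r\<^sup>2 + (4 - t\<^sup>2)) / (2 * r)"
        using r(1) by (simp add: field_simps power2_eq_square)
      have 2: "(r\<^sup>2 + (4 - t\<^sup>2)) / (2 * r) = r"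
        unfolding r(2)[symmetric] using r(1) by (simp add: power2_eq_square)
      have "k * (k / (r * (1 + y\<^sup>2 * t\<^sup>2))) - 1 / r = (k\<^sup>2 - (1 + y\<^sup>2 * t\<^sup>2)) / (r * (1 + y\<^sup>2 * t\<^sup>2))"
        using r(1) pos[of t] by (simp add: divide_simps power2_eq_square)
      also have "k\<^sup>2 - (1 + y\<^sup>2 * t\<^sup>2) = y\<^sup>2 * r\<^sup>2" unfolding k(2) r(2) by (simp add: algebra_simps)
      finally have 3: "(k * (k / (r * (1 + y\<^sup>2 * t\<^sup>2))) - 1 / r) / y\<^sup>2 = r / (1 + y\<^sup>2 * t\<^sup>2)"
        using r(1) y by (simp add: power2_eq_square)
      show ?thesis unfolding 1 2 3 f_def r_def[symmetric] using pos[of t] by (simp add: field_simps)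
    qed
    finally show ?thesis .
  qed
  have lim: "(F \<longlongrightarrow> pi - (k * (pi / 2) - pi / 2) / y\<^sup>2) (at_left 2)"
    "(F \<longlongrightarrow> - (pi - (k * (pi / 2) - pi / 2) / y\<^sup>2)) (at_right (- 2))"
  proof -
    have r: "((\<lambda>t. t * ?r t / 2) \<longlongrightarrow> 0) (at_left 2)" "((\<lambda>t. t * ?r t / 2) \<longlongrightarrow> 0) (at_right (- 2))"
      by real_asymp+
    have A: "(A l \<longlongrightarrow> pi / 2) (at_left 2)" "(A l \<longlongrightarrow> - (pi / 2)) (at_right (- 2))" if "0 < l" for l
    proof -
      have "filterlim (\<lambda>t. l * t / ?r t) at_top (at_left 2)" using that by real_asymp
      then show "(A l \<longlongrightarrow> pi / 2) (at_left 2)"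
        unfolding A_def by (rule filterlim_compose[OF tendsto_arctan_at_top])
      have "filterlim (\<lambda>t. l * t / ?r t) at_bot (at_right (- 2))" using that by real_asymp
      then show "(A l \<longlongrightarrow> - (pi / 2)) (at_right (- 2))"
        unfolding A_def by (rule filterlim_compose[OF tendsto_arctan_at_bot])
    qed
    have "(F \<longlongrightarrow> 0 + 2 * (pi / 2) - (k * (pi / 2) - pi / 2) / y\<^sup>2) (at_left 2)"
      unfolding F_def using y k by (intro tendsto_intros r A) auto
    then show "(F \<longlongrightarrow> pi - (k * (pi / 2) - pi / 2) / y\<^sup>2) (at_left 2)" by simp
    have "(F \<longlongrightarrow> 0 + 2 * (- (pi / 2)) - (k * (- (pi / 2)) - (- (pi / 2))) / y\<^sup>2) (at_right (- 2))"
      unfolding F_def using y k by (intro tendsto_intros r A) auto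
    also have "0 + 2 * (- (pi / 2)) - (k * (- (pi / 2)) - (- (pi / 2))) / y\<^sup>2 = 
      - (pi - (k * (pi / 2) - pi / 2) / y\<^sup>2)" by (simp add: diff_divide_distrib)
    finally show "(F \<longlongrightarrow> - (pi - (k * (pi / 2) - pi / 2) / y\<^sup>2)) (at_right (- 2))" .
  qed
  have "(LBINT x=ereal (- 2)..ereal 2. f x) =
      (pi - (k * (pi / 2) - pi / 2) / y\<^sup>2) - (- (pi - (k * (pi / 2) - pi / 2) / y\<^sup>2))"
  proof (rule interval_integral_FTC_nonneg)
    show "((F \<circ> real_of_ereal) \<longlongrightarrow> pi - (k * (pi / 2) - pi / 2) / y\<^sup>2) (at_left (ereal 2))"
      "((F \<circ> real_of_ereal) \<longlongrightarrow> - (pi - (k * (pi / 2) - pi / 2) / y\<^sup>2)) (at_right (ereal (- 2)))"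
      using lim by (simp_all only: ereal_tendsto_simps)
    show "isCont f x" for x
      unfolding f_def using pos[of x] by (intro continuous_intros) auto
    show "AE x in lborel. ereal (- 2) < ereal x \<longrightarrow> ereal x < ereal 2 \<longrightarrow> 0 \<le> f x"
    proof (rule AE_I2, intro impI)
      fix x assume "ereal (- 2) < ereal x" "ereal x < ereal 2"
      then have "\<bar>x\<bar>\<^sup>2 \<le> 2\<^sup>2" by (intro power_mono) auto
      then show "0 \<le> f x" using pos[of x] by (simp add: f_def)
    qed
  qed (use dF in auto)
  then have "(\<integral>t. indicator {- 2<..<2} t * f t \<partial>lborel) = 2 * pi - (k - 1) * pi / y\<^sup>2"
    by (simp add: interval_lebesgue_integral_def set_lebesgue_integral_def einterval_eq_Icc field_simps)
  moreover have "(\<integral>t. y\<^sup>2 * t\<^sup>2 / (1 + y\<^sup>2 * t\<^sup>2) \<partial>standard_semicircle) =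
      (\<integral>t. indicator {- 2<..<2} t * f t / (2 * pi) \<partial>lborel)"
  proof -
    have nonneg: "0 \<le> indicator {- 2..2} x * ?r x / (2 * pi)" for x :: real
    proof (cases "x \<in> {- 2..2}")
      case True
      then have "\<bar>x\<bar>\<^sup>2 \<le> 2\<^sup>2" by (intro power_mono) auto
      then show ?thesis by simp
    qed simp
    have "(\<integral>t. y\<^sup>2 * t\<^sup>2 / (1 + y\<^sup>2 * t\<^sup>2) \<partial>standard_semicircle) =
        (\<integral>t. (indicator {- 2..2} t * ?r t / (2 * pi)) *\<^sub>R (y\<^sup>2 * t\<^sup>2 / (1 + y\<^sup>2 * t\<^sup>2)) \<partial>lborel)"
      unfolding standard_semicircle_def by (rule integral_density) (use nonneg in auto)
    also have "\<dots> = (\<integral>t. indicator {- 2<..<2} t * f t / (2 * pi) \<partial>lborel)"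
    proof (rule Bochner_Integration.integral_cong)
      fix t :: real
      consider "t = 2" | "t = - 2" | "t \<in> {- 2<..<2}" | "t \<notin> {- 2..2}" by force
      then show "(indicator {- 2..2} t * ?r t / (2 * pi)) *\<^sub>R (y\<^sup>2 * t\<^sup>2 / (1 + y\<^sup>2 * t\<^sup>2)) =
        indicator {- 2<..<2} t * f t / (2 * pi)"
        by cases (auto simp: f_def mult_ac)
    qed simp
    finally show ?thesis .
  qed
  ultimately have "(\<integral>t. y\<^sup>2 * t\<^sup>2 / (1 + y\<^sup>2 * t\<^sup>2) \<partial>standard_semicircle) =
      (2 * pi - (k - 1) * pi / y\<^sup>2) / (2 * pi)" by simp
  also have "\<dots> = 1 - (k - 1) / (2 * y\<^sup>2)" by (simp add: diff_divide_distrib)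
  finally show ?thesis .
qed

text \<open>
  The value of the argument is the solution of \<open>w = z\<^sup>2 (1 + w)\<^sup>2\<close> for \<open>w = -c\<close>, the functional
  equation of the generating function \<open>1 + w\<close> of the Catalan numbers.
\<close>

lemma m_transform_semicircle:
  assumes c: "0 < c" "c < 1"
  shows "m_transform standard_semicircle (\<i> * complex_of_real (sqrt c / (1 - c))) = - complex_of_real c"
proof -
  define y where "y = sqrt c / (1 - c)"
  have y: "0 < y" "y\<^sup>2 = c / (1 - c)\<^sup>2" using c by (auto simp: y_def power_divide)
  define k where "k = (1 + c) / (1 - c)"
  have k: "0 < k" using c by (simp add: k_def)
  have k2: "k\<^sup>2 = 1 + 4 * y\<^sup>2"
    unfolding k_def y(2) power_divide using c by (simp add: divide_simps) (simp add: power2_eq_square algebra_simps)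
  have "1 - (k - 1) / (2 * y\<^sup>2) = c"
  proof -
    have "k - 1 = 2 * c / (1 - c)" using c by (simp add: k_def field_simps)
    then show ?thesis unfolding y(2) using c by (simp add: power2_eq_square)
  qed
  then show ?thesis unfolding y_def[symmetric]
    using m_transform_imaginary[OF finite_measure_semicircle _ symmetric_semicircle y(1)]
      semicircle_integral[OF y(1) k k2] by simp
qed

section \<open>The S-transform identity on the negative half-line\<close>

definition cauchy_square :: "real measure \<Rightarrow> complex \<Rightarrow> complex" where
  "cauchy_square M E = (\<integral>t. 1 / (E - (complex_of_real t)\<^sup>2) \<partial>M)"

lemma AE_zero_imp_return:
  assumes "real_distribution M" and ae: "AE t in M. t = 0"
  shows "M = return borel 0"
proof (rule measure_eqI)
  interpret real_distribution M by fact
  show "sets M = sets (return borel 0)" by simp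
  fix A assume A: "A \<in> sets M"
  have "emeasure M A = (\<integral>\<^sup>+ t. indicator A t \<partial>M)" using A by simp
  also have "\<dots> = (\<integral>\<^sup>+ t. indicator A 0 \<partial>M)"
    by (rule nn_integral_cong_AE) (use ae in \<open>auto elim: AE_mp\<close>)
  also have "\<dots> = indicator A 0" using emeasure_space_1 by simp
  finally show "emeasure M A = emeasure (return borel 0) A" using A by simp
qed

text \<open>
  These terms, weighted by the masses of the atoms, form the difference quotient of the moment transform between
  a point \<open>z\<close> of the left half-plane and a real point \<open>x\<close>; positivity makes it nonzero.
\<close>

lemma two_atom_ratio_pos:
  assumes z: "Re z < 0" and x: "x \<le> 0" and s: "0 < s"
  shows "0 < Re (complex_of_real s / ((1 - z * complex_of_real s) * (1 - complex_of_real (x * s))))"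
proof -
  have "x * s \<le> 0" using x s by (simp add: mult_nonpos_nonneg)
  then have xs: "0 < 1 - x * s" by simp
  have "Re z * s < 0" using z s by (simp add: mult_neg_pos)
  then have re: "0 < Re (1 - z * complex_of_real s)" by simp
  have "0 < Re (1 / d)" if "0 < Re d" for d :: complex
  proof -
    have "d \<noteq> 0" using that by auto
    then show ?thesis using that by (simp add: Re_divide')
  qed
  from this[OF re] have "0 < Re (1 / (1 - z * complex_of_real s))" .
  then have "0 < s / (1 - x * s) * Re (1 / (1 - z * complex_of_real s))"
    using xs s by simp
  also have "\<dots> = Re (complex_of_real (s / (1 - x * s)) * (1 / (1 - z * complex_of_real s)))"
    by (simp only: Re_complex_of_real times_complex.sel Im_complex_of_real)
  finally show ?thesis by (simp add: mult_ac)
qed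

context
  fixes \<nu> :: "real measure" and \<alpha> \<eta> :: real
  assumes \<nu>: "real_distribution \<nu>" and mean: "(\<integral>t. t \<partial>\<nu>) = 1"
    and \<eta>: "0 < \<eta>" "\<eta> < \<alpha>" and atoms: "0 < measure \<nu> {\<alpha>}" "0 < measure \<nu> {\<eta>}"
    and full: "measure \<nu> {\<alpha>, \<eta>} = 1"
begin

private abbreviation (input) "p \<equiv> measure \<nu> {\<alpha>}"
private abbreviation (input) "q \<equiv> measure \<nu> {\<eta>}"

lemma two_atom_weights: "p + q = 1" "p * \<alpha> + q * \<eta> = 1" "\<eta> < 1" "1 < \<alpha>"
proof -
  have int: "integral\<^sup>L \<nu> f = p *\<^sub>R f \<alpha> + q *\<^sub>R f \<eta>" if "f \<in> borel_measurable borel" for f :: "real \<Rightarrow> real"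
    by (rule integral_two_atoms[OF \<nu> _ full that]) (use \<eta> in simp)
  interpret real_distribution \<nu> by (rule \<nu>)
  show sum: "p + q = 1" using int[of "\<lambda>_. 1"] prob_space by simp
  show m: "p * \<alpha> + q * \<eta> = 1" using int[of "\<lambda>t. t"] mean by simp
  have "p * \<alpha> + q * \<eta> = (p + q) * \<eta> + p * (\<alpha> - \<eta>)"
    "p * \<alpha> + q * \<eta> = (p + q) * \<alpha> - q * (\<alpha> - \<eta>)"
    by (simp_all add: algebra_simps)
  moreover have "0 < p * (\<alpha> - \<eta>)" "0 < q * (\<alpha> - \<eta>)" using atoms \<eta> by simp_all
  ultimately show "\<eta> < 1" "1 < \<alpha>" using m unfolding sum by linarith+
qed

lemma m_transform_two_atoms:
  fixes z :: complex
  shows "m_transform \<nu> z = complex_of_real p * (z * complex_of_real \<alpha> / (1 - z * complex_of_real \<alpha>)) +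
    complex_of_real q * (z * complex_of_real \<eta> / (1 - z * complex_of_real \<eta>))"
  unfolding m_transform_def
  by (subst integral_two_atoms[OF \<nu> _ full]) (use \<eta> in \<open>auto simp: scaleR_conv_of_real\<close>)

lemma m_transform_two_atoms_real:
  assumes "x < 0"
  shows "m_transform \<nu> (complex_of_real x) =
    complex_of_real (x * (1 - \<alpha> * \<eta> * x) / ((1 - x * \<alpha>) * (1 - x * \<eta>)))"
proof -
  have "x * \<alpha> < 0" "x * \<eta> < 0" using assms \<eta> by (auto simp: mult_neg_pos)
  then have nz: "1 - x * \<alpha> \<noteq> 0" "1 - x * \<eta> \<noteq> 0" by auto
  have "p * (x * \<alpha> / (1 - x * \<alpha>)) + q * (x * \<eta> / (1 - x * \<eta>)) =
     x * ((p * \<alpha> + q * \<eta>) - (p + q) * \<alpha> * \<eta> * x) / ((1 - x * \<alpha>) * (1 - x * \<eta>))"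
    using nz by (simp add: add_frac_eq) (simp add: algebra_simps)
  moreover have "m_transform \<nu> (complex_of_real x) =
      complex_of_real (p * (x * \<alpha> / (1 - x * \<alpha>)) + q * (x * \<eta> / (1 - x * \<eta>)))"
    by (simp add: m_transform_two_atoms)
  ultimately show ?thesis unfolding two_atom_weights by simp
qed

lemma inv_into_m_transform_two_atoms:
  assumes x: "x < 0"
  shows "inv_into left_half_plane (m_transform \<nu>) (m_transform \<nu> (complex_of_real x)) = complex_of_real x"
proof -
  have im: "m_transform \<nu> (complex_of_real x) \<in> m_transform \<nu> ` left_half_plane"
    by (intro imageI) (use x in \<open>simp add: left_half_plane_def\<close>)
  define z where "z = inv_into left_half_plane (m_transform \<nu>) (m_transform \<nu> (complex_of_real x))"
  have z: "Re z < 0" using inv_into_into[OF im] by (simp add: z_def left_half_plane_def)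
  have eq: "m_transform \<nu> z = m_transform \<nu> (complex_of_real x)" using f_inv_into_f[OF im] by (simp add: z_def)
  define J where "J = (\<lambda>s. complex_of_real s / ((1 - z * complex_of_real s) * (1 - complex_of_real (x * s))))"
  have "z * complex_of_real s / (1 - z * complex_of_real s) - complex_of_real x * complex_of_real s / (1 - complex_of_real x * complex_of_real s)
      = (z - complex_of_real x) * J s" if s: "0 < s" for s
  proof -
    have "J s \<noteq> 0" using two_atom_ratio_pos[OF z less_imp_le[OF x] s] unfolding J_def by auto
    then have "1 - z * complex_of_real s \<noteq> 0" "1 - complex_of_real x * complex_of_real s \<noteq> 0"
      by (auto simp: J_def)
    then show ?thesis by (simp add: J_def diff_frac_eq) (simp add: algebra_simps)
  qed
  note d = this[of \<alpha>] this[of \<eta>]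
  have "m_transform \<nu> z - m_transform \<nu> (complex_of_real x) = (z - complex_of_real x) * (p * J \<alpha> + q * J \<eta>)"
  proof -
    have "m_transform \<nu> z - m_transform \<nu> (complex_of_real x) =
      p * (z * \<alpha> / (1 - z * \<alpha>) - complex_of_real x * \<alpha> / (1 - complex_of_real x * \<alpha>)) +
      q * (z * \<eta> / (1 - z * \<eta>) - complex_of_real x * \<eta> / (1 - complex_of_real x * \<eta>))"
      by (simp only: m_transform_two_atoms[of z] m_transform_two_atoms[of "complex_of_real x"]
          right_diff_distrib) simp
    also have "\<dots> = p * ((z - complex_of_real x) * J \<alpha>) + q * ((z - complex_of_real x) * J \<eta>)"
      using d \<eta> by simp
    finally show ?thesis by (simp only: distrib_left mult.left_commute)
  qed
  moreover have "0 < Re (p * J \<alpha> + q * J \<eta>)"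
  proof -
    have "0 < Re (J \<alpha>)" "0 < Re (J \<eta>)"
      unfolding J_def using \<eta> by (intro two_atom_ratio_pos[OF z less_imp_le[OF x]]; simp)+
    then show ?thesis using atoms by (simp add: add_pos_pos)
  qed
  ultimately have "(z - complex_of_real x) * (p * J \<alpha> + q * J \<eta>) = 0" "p * J \<alpha> + q * J \<eta> \<noteq> 0"
    using eq by (simp, metis less_irrefl zero_complex.sel(1))
  then have "z = complex_of_real x" by (metis eq_iff_diff_eq_0 mult_eq_0_iff)
  then show ?thesis by (simp add: z_def)
qed

text \<open>
  At \<open>x = - c / (\<eta> (1 - c))\<close> the atom \<open>\<eta>\<close> contributes its mass times \<open>-c\<close>, and the larger atom
  contributes at least as much in absolute value; at \<open>x = 0\<close> the transform vanishes.
\<close>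

lemma m_transform_two_atoms_surj:
  assumes c: "0 < c" "c < 1"
  obtains x where "x < 0" "m_transform \<nu> (complex_of_real x) = - complex_of_real c"
proof -
  let ?m = "\<lambda>x. p * (x * \<alpha> / (1 - x * \<alpha>)) + q * (x * \<eta> / (1 - x * \<eta>))"
  have nz: "1 - x * s \<noteq> 0" if "x \<le> 0" "0 < s" for x s :: real
    using that mult_nonpos_nonneg[of x s] by auto
  have bound: "- (x * s / (1 - x * s)) \<ge> c" if s: "\<eta> \<le> s" and x: "x = - (c / (\<eta> * (1 - c)))" for s x
  proof -
    have "c \<le> s * c / \<eta>" using s \<eta> c by (simp add: pos_le_divide_eq mult.commute)
    also have "s * c / \<eta> = - s * (x * (1 - c))"
    proof -
      have "x * (1 - c) = - (c / \<eta>)" using c \<eta> unfolding x by simp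
      then show ?thesis by simp
    qed
    finally have "c * (1 - x * s) \<le> - (x * s)" by (simp add: algebra_simps)
    moreover have "0 < 1 - x * s"
    proof -
      have "x \<le> 0" using c \<eta> unfolding x by simp
      then have "x * s \<le> 0" using s \<eta> by (simp add: mult_nonpos_nonneg)
      then show ?thesis by simp
    qed
    ultimately show ?thesis unfolding minus_divide_left by (subst pos_le_divide_eq)
  qed
  define x0 where "x0 = - (c / (\<eta> * (1 - c)))"
  have "x0 \<le> 0" using c \<eta> by (simp add: x0_def)
  have "p * c \<le> p * - (x0 * \<alpha> / (1 - x0 * \<alpha>))" "q * c \<le> q * - (x0 * \<eta> / (1 - x0 * \<eta>))"
    using bound[OF _ x0_def, of \<alpha>] bound[OF _ x0_def, of \<eta>] atoms \<eta> by (intro mult_left_mono; simp)+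
  moreover have "p * c + q * c = c" using two_atom_weights(1) by (simp flip: distrib_right)
  ultimately have "?m x0 \<le> - c" by simp
  moreover have "continuous_on {x0..0} ?m"
    using nz \<eta> by (intro continuous_intros) auto
  ultimately obtain x where x: "x0 \<le> x" "x \<le> 0" "?m x = - c"
    using IVT'[of ?m x0 "- c" 0] \<open>x0 \<le> 0\<close> c by auto
  have "x \<noteq> 0" using x(3) c by auto
  moreover have "m_transform \<nu> (complex_of_real x) = complex_of_real (?m x)"
    by (simp add: m_transform_two_atoms)
  then have "m_transform \<nu> (complex_of_real x) = complex_of_real (- c)" by (simp only: x(3))
  ultimately show ?thesis using that[of x] x(2) by simp
qed

text \<open>
  Put \<open>E = -1/y\<^sup>2\<close> and \<open>m\<^sub>\<mu>(iy) = w = -c\<close>. The preimages of \<open>w\<close> are \<open>iy\<close>, some \<open>x < 0\<close>, and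
  \<open>i\<surd>c / (1 - c)\<close>, so that the S-transform identity becomes \<open>y\<surd>c = -x\<close>, that is \<open>w = E x\<^sup>2\<close>.
  The two conclusions express \<open>m\<^sub>\<mu>(iy) = E G(E) - 1\<close> and \<open>m\<^sub>\<nu>(x)\<close> by this value.
\<close>

lemma free_conv_equation_negative:
  assumes conv: "is_free_mult_conv \<nu> standard_semicircle \<mu>" and E: "E < 0"
  obtains x where "cauchy_square \<mu> (complex_of_real E) = complex_of_real (1 / E + x\<^sup>2)"
    "E * x * (1 - \<alpha> * x) * (1 - \<eta> * x) = 1 - \<alpha> * \<eta> * x"
proof -
  have \<mu>: "real_distribution \<mu>" "symmetric_measure \<mu>" and nd: "\<mu> \<noteq> return borel 0"
    and S: "\<And>w. \<lbrakk>w \<in> m_transform \<nu> ` left_half_plane; w \<in> m_transform standard_semicircle ` upper_sector;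
       w \<in> m_transform \<mu> ` upper_sector\<rbrakk> \<Longrightarrow> S_transform upper_sector \<mu> w
          = S_transform left_half_plane \<nu> w * S_transform upper_sector standard_semicircle w"
    using conv by (auto simp: is_free_mult_conv_def)
  interpret real_distribution \<mu> by fact
  have fin: "finite_measure \<mu>" by unfold_locales
  have nz: "\<not> (AE t in \<mu>. t = 0)" using AE_zero_imp_return[OF \<mu>(1)] nd by auto
  define y where "y = 1 / sqrt (- E)"
  have y: "0 < y" "y\<^sup>2 = - (1 / E)" using E by (auto simp: y_def power_divide)
  have posy: "0 < 1 + y\<^sup>2 * t\<^sup>2" for t by (simp add: add_pos_nonneg)
  define c where "c = (\<integral>t. y\<^sup>2 * t\<^sup>2 / (1 + y\<^sup>2 * t\<^sup>2) \<partial>\<mu>)"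
  have b: "\<bar>y\<^sup>2 * t\<^sup>2 / (1 + y\<^sup>2 * t\<^sup>2)\<bar> \<le> 1" "\<bar>1 / (1 + y\<^sup>2 * t\<^sup>2)\<bar> \<le> 1" for t
    using posy[of t] by (simp_all add: abs_mult)
  have i1: "integrable \<mu> (\<lambda>t. y\<^sup>2 * t\<^sup>2 / (1 + y\<^sup>2 * t\<^sup>2))"
    by (rule integrable_const_bound[where B = 1]) (use b in \<open>simp_all del: abs_divide\<close>)
  have i2: "integrable \<mu> (\<lambda>t. 1 / (1 + y\<^sup>2 * t\<^sup>2))"
    by (rule integrable_const_bound[where B = 1]) (use b in \<open>simp_all del: abs_divide\<close>)
  have "(\<integral>t. 1 / (1 + y\<^sup>2 * t\<^sup>2) \<partial>\<mu>) = (\<integral>t. 1 - y\<^sup>2 * t\<^sup>2 / (1 + y\<^sup>2 * t\<^sup>2) \<partial>\<mu>)"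
  proof (rule Bochner_Integration.integral_cong)
    show "1 / (1 + y\<^sup>2 * t\<^sup>2) = 1 - y\<^sup>2 * t\<^sup>2 / (1 + y\<^sup>2 * t\<^sup>2)" for t
      using posy[of t] by (simp add: field_simps)
  qed simp
  also have "\<dots> = 1 - c" using i1 prob_space by (simp add: c_def)
  finally have c1: "(\<integral>t. 1 / (1 + y\<^sup>2 * t\<^sup>2) \<partial>\<mu>) = 1 - c" .
  have "0 < c" unfolding c_def
    by (rule integral_pos_if_not_AE_zero[OF i1 _ _ nz]) (use y(1) posy[THEN less_imp_le] in \<open>auto simp: add_nonneg_eq_0_iff\<close>)
  moreover have "0 < 1 - c" unfolding c1[symmetric]
    by (rule integral_pos_if_not_AE_zero[OF i2 _ _ nz]) (use posy[THEN less_imp_le] in \<open>auto simp: add_nonneg_eq_0_iff\<close>)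
  ultimately have c: "0 < c" "c < 1" by auto
  define w where "w = - complex_of_real c"
  have w0: "w \<noteq> 0" "1 + inverse w \<noteq> 0"
  proof -
    show "w \<noteq> 0" using c by (simp add: w_def)
    have "1 + inverse w = complex_of_real (1 - inverse c)" by (simp add: w_def flip: of_real_inverse)
    moreover have "1 - inverse c < 0" using c by (simp add: one_less_inverse)
    ultimately show "1 + inverse w \<noteq> 0" by (metis less_irrefl of_real_eq_0_iff)
  qed
  have wmu: "m_transform \<mu> (\<i> * complex_of_real y) = w"
    using m_transform_imaginary[OF fin _ \<mu>(2) y(1)] by (simp add: c_def w_def)
  define v where "v = sqrt c / (1 - c)"
  have v: "0 < v" using c by (simp add: v_def)
  have wsc: "m_transform standard_semicircle (\<i> * complex_of_real v) = w"
    using m_transform_semicircle[OF c] by (simp add: v_def w_def)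
  obtain x where x: "x < 0" "m_transform \<nu> (complex_of_real x) = w"
    using m_transform_two_atoms_surj[OF c] w_def by metis
  have nzsc: "\<not> (AE t in standard_semicircle. t = 0)"
  proof
    assume ae: "AE t in standard_semicircle. t = 0"
    have "m_transform standard_semicircle (\<i> * complex_of_real v) = (\<integral>t. 0 \<partial>standard_semicircle)"
      unfolding m_transform_def
    proof (rule integral_cong_AE)
      show "AE t in standard_semicircle. \<i> * complex_of_real v * complex_of_real t /
          (1 - \<i> * complex_of_real v * complex_of_real t) = 0"
        using ae by eventually_elim simp
    qed auto
    then show False using wsc w0 by simp
  qed
  have "S_transform upper_sector \<mu> w = S_transform left_half_plane \<nu> w * S_transform upper_sector standard_semicircle w"
  proof (rule S)
    show "w \<in> m_transform \<nu> ` left_half_plane" using x by (force simp: left_half_plane_def)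
    show "w \<in> m_transform standard_semicircle ` upper_sector" unfolding wsc[symmetric] using v by (intro imageI) simp
    show "w \<in> m_transform \<mu> ` upper_sector" unfolding wmu[symmetric] using y by (intro imageI) simp
  qed
  moreover have "inv_into upper_sector (m_transform \<mu>) w = \<i> * complex_of_real y"
    using inv_into_m_transform_imaginary[OF fin _ \<mu>(2) nz y(1)] wmu by simp
  moreover have "inv_into upper_sector (m_transform standard_semicircle) w = \<i> * complex_of_real v"
    using inv_into_m_transform_imaginary[OF finite_measure_semicircle _ symmetric_semicircle nzsc v] wsc by simp
  moreover have "inv_into left_half_plane (m_transform \<nu>) w = complex_of_real x"
    using inv_into_m_transform_two_atoms[OF x(1)] x(2) by simp
  ultimately have "(1 + inverse w) * (\<i> * complex_of_real y) =
      ((1 + inverse w) * complex_of_real x) * ((1 + inverse w) * (\<i> * complex_of_real v))"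
    by (simp add: S_transform_def)
  then have "(\<i> * (1 + inverse w)) * complex_of_real y =
      (\<i> * (1 + inverse w)) * (complex_of_real x * ((1 + inverse w) * complex_of_real v))"
    by (simp only: mult_ac)
  then have "complex_of_real y = complex_of_real x * ((1 + inverse w) * complex_of_real v)"
    using w0 by simp
  also have "\<dots> = complex_of_real (x * ((1 - inverse c) * v))" by (simp add: w_def)
  finally have "y = x * ((1 - inverse c) * v)" by (simp only: of_real_eq_iff)
  also have "(1 - inverse c) * v = - (1 / sqrt c)"
  proof -
    have "1 - inverse c = - ((1 - c) / c)" using c by (simp add: field_simps)
    then have "(1 - inverse c) * v = - (sqrt c / c)" using c by (simp add: v_def)
    then show ?thesis using sqrt_divide_self_eq[of c] c by (simp add: inverse_eq_divide)
  qed
  finally have "y * sqrt c = - x" using c by simp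
  then have "(y * sqrt c)\<^sup>2 = x\<^sup>2" by simp
  then have cy: "y\<^sup>2 * c = x\<^sup>2" using c by (simp add: power_mult_distrib)
  have "cauchy_square \<mu> (complex_of_real E) = complex_of_real (\<integral>t. 1 / (E - t\<^sup>2) \<partial>\<mu>)"
    unfolding cauchy_square_def by (subst integral_complex_of_real[symmetric]) simp
  also have "(\<integral>t. 1 / (E - t\<^sup>2) \<partial>\<mu>) = (\<integral>t. - y\<^sup>2 * (1 / (1 + y\<^sup>2 * t\<^sup>2)) \<partial>\<mu>)"
  proof (rule Bochner_Integration.integral_cong)
    fix t
    have "E - t\<^sup>2 = E * (1 + y\<^sup>2 * t\<^sup>2)" using E unfolding y(2) by (simp add: field_simps)
    then show "1 / (E - t\<^sup>2) = - y\<^sup>2 * (1 / (1 + y\<^sup>2 * t\<^sup>2))" by (simp add: y(2))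
  qed simp
  also have "\<dots> = - y\<^sup>2 * (1 - c)" unfolding c1[symmetric] by (rule integral_mult_right_zero)
  also have "\<dots> = - y\<^sup>2 + x\<^sup>2" unfolding cy[symmetric] by (simp add: algebra_simps)
  also have "- y\<^sup>2 = 1 / E" using y(2) by simp
  finally have G: "cauchy_square \<mu> (complex_of_real E) = complex_of_real (1 / E + x\<^sup>2)" .
  have "x * \<alpha> < 0" "x * \<eta> < 0" using x(1) \<eta> by (auto simp: mult_neg_pos)
  then have nz': "(1 - x * \<alpha>) * (1 - x * \<eta>) \<noteq> 0" by auto
  have "complex_of_real (- c) = complex_of_real (x * (1 - \<alpha> * \<eta> * x) / ((1 - x * \<alpha>) * (1 - x * \<eta>)))"
    using m_transform_two_atoms_real[OF x(1)] x(2) by (simp add: w_def)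
  then have "- c = x * (1 - \<alpha> * \<eta> * x) / ((1 - x * \<alpha>) * (1 - x * \<eta>))" by (simp only: of_real_eq_iff)
  moreover have "- c = E * x\<^sup>2" using cy E by (simp add: y(2) field_simps)
  ultimately have "E * x\<^sup>2 * ((1 - x * \<alpha>) * (1 - x * \<eta>)) = x * (1 - \<alpha> * \<eta> * x)"
    using nz' by simp
  then have "x * (E * x * (1 - \<alpha> * x) * (1 - \<eta> * x)) = x * (1 - \<alpha> * \<eta> * x)"
    by (simp add: power2_eq_square mult_ac)
  then show ?thesis using that[OF G] x(1) by simp
qed

end

section \<open>Analytic continuation\<close>

lemma cauchy_square_integrable:
  assumes fin: "finite_measure M" and [measurable_cong]: "sets M = sets borel"
    and d: "0 < d" "AE t in M. d \<le> norm (E - (complex_of_real t)\<^sup>2)"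
  shows "integrable M (\<lambda>t. 1 / (E - (complex_of_real t)\<^sup>2))"
proof (rule finite_measure.integrable_const_bound[OF fin, where B = "1 / d"])
  show "AE t in M. norm (1 / (E - (complex_of_real t)\<^sup>2)) \<le> 1 / d"
    using d(2) by eventually_elim (use d(1) in \<open>simp add: norm_divide frac_le\<close>)
qed measurable

text \<open>
  Differentiation under the integral sign, by dominated convergence of the difference
  quotients. The distance is bounded below only almost everywhere, so that the lemma also applies
  at positive \<open>E\<close> near which \<open>t\<^sup>2\<close> has no mass.
\<close>

lemma cauchy_square_has_field_derivative:
  assumes fin: "finite_measure M" and [measurable_cong]: "sets M = sets borel"
    and d: "0 < d" "AE t in M. 2 * d \<le> norm (E - (complex_of_real t)\<^sup>2)"
  shows "(cauchy_square M has_field_derivative - (\<integral>t. 1 / (E - (complex_of_real t)\<^sup>2)\<^sup>2 \<partial>M)) (at E)"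
proof -
  let ?k = "\<lambda>w t. 1 / (w - (complex_of_real t)\<^sup>2)"
  have lower: "AE t in M. d \<le> norm (w - (complex_of_real t)\<^sup>2)" if "w \<in> ball E d" for w
    using d(2)
  proof eventually_elim
    fix t assume t: "2 * d \<le> norm (E - (complex_of_real t)\<^sup>2)"
    have "norm (E - (complex_of_real t)\<^sup>2) \<le> norm (E - w) + norm (w - (complex_of_real t)\<^sup>2)"
      using norm_triangle_ineq[of "E - w" "w - (complex_of_real t)\<^sup>2"] by simp
    then show "d \<le> norm (w - (complex_of_real t)\<^sup>2)" using t that by (simp add: dist_norm)
  qed
  have "E \<in> ball E d" using d(1) by simp
  have "((\<lambda>w. (cauchy_square M w - cauchy_square M E) / (w - E)) \<longlongrightarrow> - (\<integral>t. (?k E t)\<^sup>2 \<partial>M)) (at E within ball E d)"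
    unfolding tendsto_at_iff_sequentially
  proof (intro allI impI)
    fix X :: "nat \<Rightarrow> complex"
    assume X: "\<forall>i. X i \<in> ball E d - {E}" "X \<longlonglongrightarrow> E"
    have "(\<lambda>i. \<integral>t. - (?k (X i) t * ?k E t) \<partial>M) \<longlonglongrightarrow> (\<integral>t. - (?k E t)\<^sup>2 \<partial>M)"
    proof (rule integral_dominated_convergence)
      show "AE t in M. (\<lambda>i. - (?k (X i) t * ?k E t)) \<longlonglongrightarrow> - (?k E t)\<^sup>2"
        using lower[OF \<open>E \<in> ball E d\<close>]
      proof eventually_elim
        fix t assume "d \<le> norm (E - (complex_of_real t)\<^sup>2)"
        then have "E - (complex_of_real t)\<^sup>2 \<noteq> 0" using d(1) by auto
        then show "(\<lambda>i. - (?k (X i) t * ?k E t)) \<longlonglongrightarrow> - (?k E t)\<^sup>2"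
          unfolding power2_eq_square by (intro tendsto_intros X(2))
      qed
      show "AE t in M. norm (- (?k (X i) t * ?k E t)) \<le> 1 / d * (1 / d)" for i
      proof -
        have "X i \<in> ball E d" using X(1) by blast
        from lower[OF this] lower[OF \<open>E \<in> ball E d\<close>] show ?thesis
        proof eventually_elim
          fix t assume "d \<le> norm (X i - (complex_of_real t)\<^sup>2)" "d \<le> norm (E - (complex_of_real t)\<^sup>2)"
          then have "norm (?k (X i) t) \<le> 1 / d" "norm (?k E t) \<le> 1 / d"
            using d(1) by (simp_all add: norm_divide frac_le)
          then have "norm (?k (X i) t) * norm (?k E t) \<le> 1 / d * (1 / d)"
            using d(1) by (intro mult_mono) auto
          then show "norm (- (?k (X i) t * ?k E t)) \<le> 1 / d * (1 / d)"
            by (simp only: norm_minus_cancel norm_mult)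
        qed
      qed
      show "integrable M (\<lambda>t. 1 / d * (1 / d))" by (rule finite_measure.integrable_const[OF fin])
    qed measurable
    moreover have "(\<integral>t. - (?k (X i) t * ?k E t) \<partial>M) = (cauchy_square M (X i) - cauchy_square M E) / (X i - E)" for i
    proof -
      have Xi: "X i \<in> ball E d" "X i \<noteq> E" using X(1) by auto
      have "cauchy_square M (X i) - cauchy_square M E = (\<integral>t. ?k (X i) t - ?k E t \<partial>M)"
        unfolding cauchy_square_def
        by (rule Bochner_Integration.integral_diff[symmetric])
          (intro cauchy_square_integrable[OF fin assms(2) d(1)] lower Xi \<open>E \<in> ball E d\<close>)+
      also have "\<dots> = (\<integral>t. (X i - E) * - (?k (X i) t * ?k E t) \<partial>M)"
      proof (rule integral_cong_AE)
        show "AE t in M. ?k (X i) t - ?k E t = (X i - E) * - (?k (X i) t * ?k E t)"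
          using lower[OF Xi(1)] lower[OF \<open>E \<in> ball E d\<close>]
        proof eventually_elim
          fix t assume "d \<le> norm (X i - (complex_of_real t)\<^sup>2)" "d \<le> norm (E - (complex_of_real t)\<^sup>2)"
          then have "X i - (complex_of_real t)\<^sup>2 \<noteq> 0" "E - (complex_of_real t)\<^sup>2 \<noteq> 0" using d(1) by auto
          then show "?k (X i) t - ?k E t = (X i - E) * - (?k (X i) t * ?k E t)"
            by (simp add: diff_frac_eq) (simp add: minus_divide_left)
        qed
      qed measurable
      also have "\<dots> = (X i - E) * (\<integral>t. - (?k (X i) t * ?k E t) \<partial>M)" by (rule integral_mult_right_zero)
      finally show ?thesis using Xi(2) by simp
    qed
    ultimately show "((\<lambda>w. (cauchy_square M w - cauchy_square M E) / (w - E)) \<circ> X) \<longlonglongrightarrow> - (\<integral>t. (?k E t)\<^sup>2 \<partial>M)"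
      by (simp add: o_def)
  qed
  then have "(cauchy_square M has_field_derivative - (\<integral>t. (?k E t)\<^sup>2 \<partial>M)) (at E within ball E d)"
    by (simp add: has_field_derivative_iff)
  then show ?thesis
    using at_within_open[OF \<open>E \<in> ball E d\<close> open_ball] by (simp add: power_one_over)
qed

definition slit_plane :: "complex set" where
  "slit_plane = - (complex_of_real ` {0..})"

lemma open_slit_plane: "open slit_plane"
  unfolding slit_plane_def by (intro open_Compl closed_slot_right)

lemma connected_slit_plane: "connected slit_plane"
  unfolding slit_plane_def by (intro starlike_imp_connected starlike_slotted_complex_plane_right)

lemma slit_plane_nonzero: "E \<in> slit_plane \<Longrightarrow> E \<noteq> 0"
  by (auto simp: slit_plane_def)

lemma slit_plane_distance:
  assumes "E \<in> slit_plane"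
  obtains d where "0 < d" "\<And>t. 2 * d \<le> norm (E - (complex_of_real t)\<^sup>2)"
proof -
  obtain e where e: "0 < e" "ball E e \<subseteq> slit_plane"
    using open_slit_plane assms open_contains_ball by metis
  have "e \<le> norm (E - (complex_of_real t)\<^sup>2)" for t
  proof (rule ccontr)
    assume "\<not> e \<le> norm (E - (complex_of_real t)\<^sup>2)"
    then have "(complex_of_real t)\<^sup>2 \<in> slit_plane" using e(2) by (auto simp: dist_norm)
    moreover have "(complex_of_real t)\<^sup>2 = complex_of_real (t\<^sup>2)" by simp
    ultimately show False unfolding slit_plane_def by (metis ComplD atLeast_iff imageI zero_le_power2)
  qed
  then show ?thesis using that[of "e / 2"] e(1) by simp
qed

lemma cauchy_square_holomorphic:
  assumes "finite_measure M" "sets M = sets borel"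
  shows "cauchy_square M holomorphic_on slit_plane"
proof (rule holomorphic_onI)
  fix E assume "E \<in> slit_plane"
  then obtain d where "0 < d" "\<And>t. 2 * d \<le> norm (E - (complex_of_real t)\<^sup>2)"
    using slit_plane_distance by metis
  then have "cauchy_square M field_differentiable (at E)"
    using cauchy_square_has_field_derivative[OF assms, of d E] unfolding field_differentiable_def by auto
  then show "cauchy_square M field_differentiable (at E within slit_plane)"
    by (rule field_differentiable_at_within)
qed

text \<open>
  In the cubic, written as \<open>x B = A\<close> with \<open>A = 1 + E(\<alpha> + \<eta>)x\<^sup>2\<close> and \<open>B = E + \<alpha>\<eta> + E\<alpha>\<eta>x\<^sup>2\<close>, the
  unknown occurs in \<open>A\<close> and \<open>B\<close> only through \<open>y = x\<^sup>2\<close>. Squaring eliminates it, which leaves a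
  polynomial relation for the single-valued function \<open>y = G(E) - 1/E\<close>.
\<close>

definition squared_relation :: "real \<Rightarrow> real \<Rightarrow> complex \<Rightarrow> complex \<Rightarrow> complex" where
  "squared_relation \<alpha> \<eta> E y =
     y * (E + \<alpha> * \<eta> + E * (\<alpha> * \<eta>) * y)\<^sup>2 - (1 + E * (\<alpha> + \<eta>) * y)\<^sup>2"

lemma squared_relation_of_root:
  assumes "E * x * (1 - complex_of_real \<alpha> * x) * (1 - complex_of_real \<eta> * x) = 1 - complex_of_real (\<alpha> * \<eta>) * x"
  shows "squared_relation \<alpha> \<eta> E (x\<^sup>2) = 0"
proof -
  have "x * (E + \<alpha> * \<eta> + E * (\<alpha> * \<eta>) * x\<^sup>2) = 1 + E * (\<alpha> + \<eta>) * x\<^sup>2"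
    using assms by (simp add: algebra_simps power2_eq_square)
  then have "(x * (E + \<alpha> * \<eta> + E * (\<alpha> * \<eta>) * x\<^sup>2))\<^sup>2 = (1 + E * (\<alpha> + \<eta>) * x\<^sup>2)\<^sup>2" by simp
  then show ?thesis unfolding squared_relation_def power_mult_distrib by simp
qed

lemma squared_relation_imp_root:
  assumes rel: "squared_relation \<alpha> \<eta> E y = 0"
    and B: "E + \<alpha> * \<eta> + E * (\<alpha> * \<eta>) * y \<noteq> 0"
  defines "x \<equiv> (1 + E * (\<alpha> + \<eta>) * y) / (E + \<alpha> * \<eta> + E * (\<alpha> * \<eta>) * y)"
  shows "x\<^sup>2 = y" "E * x * (1 - complex_of_real \<alpha> * x) * (1 - complex_of_real \<eta> * x) = 1 - complex_of_real (\<alpha> * \<eta>) * x"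
proof -
  have "(1 + E * (\<alpha> + \<eta>) * y)\<^sup>2 = y * (E + \<alpha> * \<eta> + E * (\<alpha> * \<eta>) * y)\<^sup>2"
    using rel by (simp add: squared_relation_def)
  then show x2: "x\<^sup>2 = y" unfolding x_def power_divide using B by simp
  have "x * (E + \<alpha> * \<eta> + E * (\<alpha> * \<eta>) * y) = 1 + E * (\<alpha> + \<eta>) * y" unfolding x_def using B by simp
  then have "x * (E + \<alpha> * \<eta> + E * (\<alpha> * \<eta>) * x\<^sup>2) = 1 + E * (\<alpha> + \<eta>) * x\<^sup>2" unfolding x2 .
  then show "E * x * (1 - complex_of_real \<alpha> * x) * (1 - complex_of_real \<eta> * x) = 1 - complex_of_real (\<alpha> * \<eta>) * x"
    by (simp add: algebra_simps power2_eq_square)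
qed

text \<open>
  If \<open>B\<close> vanishes, so does \<open>A\<close>, and the two equations force \<open>E\<close> to be a certain negative
  number. Elsewhere \<open>x = A/B\<close> recovers a solution of the cubic.
\<close>

lemma squared_relation_denominator:
  assumes rel: "squared_relation \<alpha> \<eta> E y = 0"
    and \<eta>: "0 < \<eta>" "\<eta> < \<alpha>" and \<alpha>: "1 < \<alpha>"
    and B: "E + \<alpha> * \<eta> + E * (\<alpha> * \<eta>) * y = 0"
  shows "E \<in> complex_of_real ` {..<0}"
proof -
  have "1 + E * (\<alpha> + \<eta>) * y = 0" using rel B by (simp add: squared_relation_def)
  then have "(\<alpha> + \<eta>) * (E + \<alpha> * \<eta> + E * (\<alpha> * \<eta>) * y) = (\<alpha> + \<eta>) * (E + \<alpha> * \<eta>) - \<alpha> * \<eta>"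
    by algebra
  then have "(\<alpha> + \<eta>) * E = \<alpha> * \<eta> - (\<alpha> + \<eta>) * (\<alpha> * \<eta>)" unfolding B by (simp add: algebra_simps)
  also have "\<dots> = complex_of_real (- (\<alpha> * \<eta> * (\<alpha> + \<eta> - 1)))" by (simp add: algebra_simps)
  finally have eq: "(\<alpha> + \<eta>) * E = complex_of_real (- (\<alpha> * \<eta> * (\<alpha> + \<eta> - 1)))" .
  have "complex_of_real (\<alpha> + \<eta>) \<noteq> 0" using \<eta> \<alpha> by (subst of_real_eq_0_iff) linarith
  then have "E = complex_of_real (- (\<alpha> * \<eta> * (\<alpha> + \<eta> - 1)) / (\<alpha> + \<eta>))"
    unfolding of_real_divide eq[symmetric] by simp
  moreover have "- (\<alpha> * \<eta> * (\<alpha> + \<eta> - 1)) / (\<alpha> + \<eta>) < 0"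
    using \<eta> \<alpha> by (intro divide_neg_pos) auto
  ultimately show ?thesis by blast
qed

context
  fixes \<mu> :: "real measure" and \<alpha> \<eta> :: real
  assumes \<mu>: "finite_measure \<mu>" "sets \<mu> = sets borel"
    and \<eta>: "0 < \<eta>" "\<eta> < \<alpha>" and \<alpha>: "1 < \<alpha>"
    and neg: "\<And>E. E < 0 \<Longrightarrow> \<exists>x. cauchy_square \<mu> (complex_of_real E) = complex_of_real (1 / E + x\<^sup>2) \<and>
      E * x * (1 - \<alpha> * x) * (1 - \<eta> * x) = 1 - \<alpha> * \<eta> * x"
begin

text \<open>
  Identity theorem: the relation is holomorphic in \<open>E\<close> and holds on the negative half-line.
\<close>

lemma squared_relation_slit_plane:
  assumes "E \<in> slit_plane"
  shows "squared_relation \<alpha> \<eta> E (cauchy_square \<mu> E - 1 / E) = 0"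
proof (rule analytic_continuation[where f = "\<lambda>E. squared_relation \<alpha> \<eta> E (cauchy_square \<mu> E - 1 / E)"
      and S = slit_plane and U = "complex_of_real ` {..<0}" and \<xi> = "- 1"])
  show "(\<lambda>E. squared_relation \<alpha> \<eta> E (cauchy_square \<mu> E - 1 / E)) holomorphic_on slit_plane"
    unfolding squared_relation_def
    by (intro holomorphic_intros cauchy_square_holomorphic \<mu>) (auto simp: slit_plane_nonzero)
  show "complex_of_real ` {..<0} \<subseteq> slit_plane" by (auto simp: slit_plane_def)
  then show "- 1 \<in> slit_plane" by (auto simp: slit_plane_def complex_eq_iff)
  show "- 1 islimpt complex_of_real ` {..<0}"
    unfolding islimpt_approachable
  proof (intro allI impI)
    fix e :: real assume "0 < e"
    then have "complex_of_real (- 1 - e / 2) \<in> complex_of_real ` {..<0} \<and>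
        complex_of_real (- 1 - e / 2) \<noteq> - 1 \<and> dist (complex_of_real (- 1 - e / 2)) (- 1) < e"
      by (intro conjI imageI) (auto simp: dist_norm complex_eq_iff norm_divide)
    then show "\<exists>x'\<in>complex_of_real ` {..<0}. x' \<noteq> - 1 \<and> dist x' (- 1) < e" by blast
  qed
  fix z assume "z \<in> complex_of_real ` {..<0}"
  then obtain r where r: "r < 0" "z = complex_of_real r" by auto
  then obtain x where x: "cauchy_square \<mu> z = complex_of_real (1 / r + x\<^sup>2)"
    "r * x * (1 - \<alpha> * x) * (1 - \<eta> * x) = 1 - \<alpha> * \<eta> * x" using neg by blast
  have "complex_of_real (r * x * (1 - \<alpha> * x) * (1 - \<eta> * x)) = complex_of_real (1 - \<alpha> * \<eta> * x)"
    using x(2) by simp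
  then have "squared_relation \<alpha> \<eta> z ((complex_of_real x)\<^sup>2) = 0"
    by (intro squared_relation_of_root) (simp add: r(2))
  then show "squared_relation \<alpha> \<eta> z (cauchy_square \<mu> z - 1 / z) = 0" using x(1) unfolding r(2) by simp
qed (use assms open_slit_plane connected_slit_plane in auto)

lemma cauchy_square_root_upper:
  assumes "0 < Im E"
  obtains x where "cauchy_square \<mu> E = 1 / E + x\<^sup>2"
    "E * x * (1 - complex_of_real \<alpha> * x) * (1 - complex_of_real \<eta> * x) = 1 - complex_of_real (\<alpha> * \<eta>) * x"
proof -
  have "E \<in> slit_plane" using assms by (auto simp: slit_plane_def)
  note rel = squared_relation_slit_plane[OF this]
  have "E + \<alpha> * \<eta> + E * (\<alpha> * \<eta>) * (cauchy_square \<mu> E - 1 / E) \<noteq> 0"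
    using squared_relation_denominator[OF rel \<eta> \<alpha>] assms by auto
  from squared_relation_imp_root[OF rel this] show ?thesis using that by (metis add_diff_cancel_left' diff_add_cancel add.commute)
qed

text \<open>
  The relation passes from the points \<open>E + i/n\<close> to \<open>E\<close>, since \<open>G\<close> is continuous there.
\<close>

lemma cauchy_square_root_real:
  assumes E: "0 < E" and d: "0 < d" "AE t in \<mu>. 2 * d \<le> \<bar>E - t\<^sup>2\<bar>"
  obtains x where "(\<integral>t. 1 / (E - t\<^sup>2) \<partial>\<mu>) = 1 / E + x\<^sup>2"
    "E * x * (1 - \<alpha> * x) * (1 - \<eta> * x) = 1 - \<alpha> * \<eta> * x"
proof -
  let ?E = "complex_of_real E"
  define y where "y = (\<integral>t. 1 / (E - t\<^sup>2) \<partial>\<mu>) - 1 / E"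
  have "norm (?E - (complex_of_real t)\<^sup>2) = \<bar>E - t\<^sup>2\<bar>" for t
    by (metis norm_of_real of_real_diff of_real_power)
  then have "AE t in \<mu>. 2 * d \<le> norm (?E - (complex_of_real t)\<^sup>2)" using d(2) by simp
  from cauchy_square_has_field_derivative[OF \<mu> d(1) this] have "isCont (cauchy_square \<mu>) ?E"
    by (rule DERIV_isCont)
  then have cont: "isCont (\<lambda>E. squared_relation \<alpha> \<eta> E (cauchy_square \<mu> E - 1 / E)) ?E"
    unfolding squared_relation_def using E by (intro continuous_intros) auto
  have "(\<lambda>n. ?E + \<i> * complex_of_real (inverse (real (Suc n)))) \<longlonglongrightarrow> ?E + \<i> * complex_of_real 0"
    by (intro tendsto_intros LIMSEQ_inverse_real_of_nat)
  then have "(\<lambda>n. ?E + \<i> * complex_of_real (inverse (real (Suc n)))) \<longlonglongrightarrow> ?E" by simp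
  from isCont_tendsto_compose[OF cont this]
  have "(\<lambda>n. 0) \<longlonglongrightarrow> squared_relation \<alpha> \<eta> ?E (cauchy_square \<mu> ?E - 1 / ?E)"
  proof (rule Lim_transform_eventually, intro always_eventually allI)
    fix n
    have "?E + \<i> * complex_of_real (inverse (real (Suc n))) \<in> slit_plane"
      by (auto simp: slit_plane_def complex_eq_iff)
    from squared_relation_slit_plane[OF this] show "squared_relation \<alpha> \<eta> (?E + \<i> * complex_of_real (inverse (real (Suc n))))
       (cauchy_square \<mu> (?E + \<i> * complex_of_real (inverse (real (Suc n)))) - 1 / (?E + \<i> * complex_of_real (inverse (real (Suc n))))) = 0" .
  qed
  then have "squared_relation \<alpha> \<eta> ?E (cauchy_square \<mu> ?E - 1 / ?E) = 0"
    using LIMSEQ_unique tendsto_const by blast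
  moreover have "cauchy_square \<mu> ?E = complex_of_real (\<integral>t. 1 / (E - t\<^sup>2) \<partial>\<mu>)"
    unfolding cauchy_square_def by (subst integral_complex_of_real[symmetric]) simp
  ultimately have rel: "squared_relation \<alpha> \<eta> ?E (complex_of_real y) = 0" by (simp add: y_def)
  have B: "?E + \<alpha> * \<eta> + ?E * (\<alpha> * \<eta>) * complex_of_real y \<noteq> 0"
    using squared_relation_denominator[OF rel \<eta> \<alpha>] E by auto
  define x where "x = (1 + E * (\<alpha> + \<eta>) * y) / (E + \<alpha> * \<eta> + E * (\<alpha> * \<eta>) * y)"
  have xc: "(1 + ?E * (\<alpha> + \<eta>) * complex_of_real y) / (?E + \<alpha> * \<eta> + ?E * (\<alpha> * \<eta>) * complex_of_real y) = complex_of_real x"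
    by (simp add: x_def)
  have "complex_of_real (x\<^sup>2) = complex_of_real y"
    using squared_relation_imp_root(1)[OF rel B] unfolding xc by simp
  then have "x\<^sup>2 = y" by (simp only: of_real_eq_iff)
  then have "(\<integral>t. 1 / (E - t\<^sup>2) \<partial>\<mu>) = 1 / E + x\<^sup>2" by (simp add: y_def)
  moreover have "complex_of_real (E * x * (1 - \<alpha> * x) * (1 - \<eta> * x)) = complex_of_real (1 - \<alpha> * \<eta> * x)"
    using squared_relation_imp_root(2)[OF rel B] unfolding xc by simp
  then have "E * x * (1 - \<alpha> * x) * (1 - \<eta> * x) = 1 - \<alpha> * \<eta> * x" by (simp only: of_real_eq_iff)
  ultimately show ?thesis using that[of x] by blast
qed

end

section \<open>Points where all solutions are real\<close>

definition cubic_root :: "real \<Rightarrow> real \<Rightarrow> real \<Rightarrow> real \<Rightarrow> bool" where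
  "cubic_root \<alpha> \<eta> E x \<longleftrightarrow> E * x * (1 - \<alpha> * x) * (1 - \<eta> * x) = 1 - \<alpha> * \<eta> * x"

text \<open>
  Solutions stay bounded as \<open>E\<close> approaches the positive axis: for large \<open>x\<close> the left
  side of the cubic grows like \<open>x\<^sup>3\<close> and the right side like \<open>x\<close>.
\<close>

lemma cubic_solution_bound:
  fixes x E :: complex
  assumes \<eta>: "0 < \<eta>" "\<eta> < \<alpha>" and e: "0 < e" "e \<le> norm E"
    and eq: "E * x * (1 - complex_of_real \<alpha> * x) * (1 - complex_of_real \<eta> * x) = 1 - complex_of_real (\<alpha> * \<eta>) * x"
  shows "norm x \<le> 2 / \<eta> + 1 + 4 * (1 + \<alpha> * \<eta>) / (e * (\<alpha> * \<eta>))"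
proof (rule ccontr)
  let ?C = "4 * (1 + \<alpha> * \<eta>) / (e * (\<alpha> * \<eta>))"
  assume "\<not> norm x \<le> 2 / \<eta> + 1 + ?C"
  moreover have pos: "0 < \<alpha> * \<eta>" using \<eta> by simp
  moreover have "0 < ?C" using e(1) \<eta> by (intro divide_pos_pos mult_pos_pos add_pos_pos) auto
  moreover have "0 < 2 / \<eta>" using \<eta> by simp
  ultimately have x: "2 / \<eta> < norm x" "1 < norm x" "?C < norm x" by linarith+
  \<comment> \<open>beyond \<open>2 / \<eta>\<close> both linear factors are at least half as large as their leading terms\<close>
  have lin: "s * norm x / 2 \<le> norm (1 - complex_of_real s * x)" if "\<eta> \<le> s" for s
  proof -
    have "2 < \<eta> * norm x" using x(1) \<eta>(1) by (simp add: divide_less_eq mult.commute)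
    also have "\<dots> \<le> s * norm x" using that by (intro mult_right_mono) auto
    finally have "2 < s * norm x" .
    moreover have "s * norm x - 1 \<le> norm (1 - complex_of_real s * x)"
      using norm_triangle_ineq2[of "complex_of_real s * x" 1] that \<eta>
      by (simp add: norm_mult norm_minus_commute)
    ultimately show ?thesis by linarith
  qed
  have "e * norm x * (\<alpha> * norm x / 2) * (\<eta> * norm x / 2) \<le>
      norm E * norm x * norm (1 - complex_of_real \<alpha> * x) * norm (1 - complex_of_real \<eta> * x)"
    using e \<eta> lin[of \<alpha>] lin[of \<eta>] by (intro mult_mono) auto
  also have "\<dots> = norm (1 - complex_of_real (\<alpha> * \<eta>) * x)" unfolding eq[symmetric] by (simp add: norm_mult)
  also have "\<dots> \<le> 1 + (\<alpha> * \<eta>) * norm x"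
    using norm_triangle_ineq4[of 1 "complex_of_real (\<alpha> * \<eta>) * x"] \<eta> by (simp add: norm_mult)
  also have "\<dots> \<le> (1 + \<alpha> * \<eta>) * norm x" using x(2) by (simp add: algebra_simps)
  finally have "norm x * (e * (\<alpha> * \<eta>) * (norm x)\<^sup>2) \<le> norm x * (4 * (1 + \<alpha> * \<eta>))"
    by (simp add: algebra_simps power2_eq_square)
  then have "e * (\<alpha> * \<eta>) * (norm x)\<^sup>2 \<le> 4 * (1 + \<alpha> * \<eta>)"
    using x(2) by (simp only: mult_le_cancel_left)
  then have "(norm x)\<^sup>2 \<le> ?C" using e(1) pos by (simp add: pos_le_divide_eq mult.commute)
  moreover have "norm x * 1 \<le> (norm x)\<^sup>2" unfolding power2_eq_square using x(2) by (intro mult_left_mono) auto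
  ultimately show False using x(3) by simp
qed

text \<open>
  At \<open>E + i\<epsilon>\<close> the cubic is its factorisation at \<open>E\<close> plus a perturbation of order \<open>\<epsilon>\<close>. Since
  the roots at \<open>E\<close> are real, each factor \<open>x - r\<close> has modulus at least \<open>\<bar>Im x\<bar>\<close>.
\<close>

lemma real_roots_imp_Im_le:
  fixes x :: complex
  assumes \<eta>: "0 < \<eta>" "\<eta> < \<alpha>" and E: "0 < E" and \<epsilon>: "0 < \<epsilon>"
    and roots: "cubic_root \<alpha> \<eta> E r1" "cubic_root \<alpha> \<eta> E r2" "cubic_root \<alpha> \<eta> E r3"
    and distinct: "r1 \<noteq> r2" "r1 \<noteq> r3" "r2 \<noteq> r3"
    and eq: "(E + \<i> * \<epsilon>) * x * (1 - complex_of_real \<alpha> * x) * (1 - complex_of_real \<eta> * x) = 1 - complex_of_real (\<alpha> * \<eta>) * x"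
    and R: "norm x \<le> R"
  shows "\<bar>Im x\<bar> ^ 3 \<le> (1 + \<alpha> * \<eta> * R) / (\<alpha> * \<eta> * E\<^sup>2) * \<epsilon>"
proof -
  have pos: "0 < \<alpha> * \<eta>" using \<eta> by simp
  let ?P = "x * (1 - complex_of_real \<alpha> * x) * (1 - complex_of_real \<eta> * x)"
  have "(E + \<i> * \<epsilon>) * ?P = 1 - complex_of_real (\<alpha> * \<eta>) * x" using eq by (simp add: mult.assoc)
  then have "norm (complex_of_real E + \<i> * \<epsilon>) * norm ?P = norm (1 - complex_of_real (\<alpha> * \<eta>) * x)"
    by (metis norm_mult)
  also have "\<dots> \<le> 1 + (\<alpha> * \<eta>) * norm x"
    using norm_triangle_ineq4[of 1 "complex_of_real (\<alpha> * \<eta>) * x"] \<eta> by (simp add: norm_mult)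
  also have "\<dots> \<le> 1 + (\<alpha> * \<eta>) * R" using R pos by (intro add_left_mono mult_left_mono) auto
  finally have "norm (complex_of_real E + \<i> * \<epsilon>) * norm ?P \<le> 1 + (\<alpha> * \<eta>) * R" .
  moreover have "E * norm ?P \<le> norm (complex_of_real E + \<i> * \<epsilon>) * norm ?P"
    using complex_Re_le_cmod[of "complex_of_real E + \<i> * \<epsilon>"] by (intro mult_right_mono) auto
  ultimately have P: "E * norm ?P \<le> 1 + (\<alpha> * \<eta>) * R" by linarith
  have "complex_of_real (\<alpha> * \<eta> * E) * x ^ 3 + complex_of_real (- (\<alpha> + \<eta>) * E) * x\<^sup>2 +
      complex_of_real (E + \<alpha> * \<eta>) * x + complex_of_real (- 1) =
      complex_of_real (\<alpha> * \<eta> * E) * (x - complex_of_real r1) * (x - complex_of_real r2) * (x - complex_of_real r3)"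
    by (rule cubic_eq_product_of_roots[OF distinct])
      (use roots in \<open>auto simp: cubic_root_def algebra_simps power2_eq_square power3_eq_cube\<close>)
  moreover have "complex_of_real (\<alpha> * \<eta> * E) * x ^ 3 + complex_of_real (- (\<alpha> + \<eta>) * E) * x\<^sup>2 +
      complex_of_real (E + \<alpha> * \<eta>) * x + complex_of_real (- 1) =
      E * ?P - (1 - complex_of_real (\<alpha> * \<eta>) * x)"
    by (simp add: algebra_simps power2_eq_square power3_eq_cube)
  moreover have "E * ?P - (1 - complex_of_real (\<alpha> * \<eta>) * x) = - (\<i> * \<epsilon>) * ?P"
    using eq by (simp add: algebra_simps)
  ultimately have fac: "complex_of_real (\<alpha> * \<eta> * E) * (x - complex_of_real r1) * (x - complex_of_real r2) * (x - complex_of_real r3) =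
      - (\<i> * \<epsilon>) * ?P" by simp
  have "\<alpha> * \<eta> * E * (norm (x - complex_of_real r1) * norm (x - complex_of_real r2) * norm (x - complex_of_real r3)) =
      norm (complex_of_real (\<alpha> * \<eta> * E) * (x - complex_of_real r1) * (x - complex_of_real r2) * (x - complex_of_real r3))"
    using pos E \<eta> by (simp add: norm_mult)
  also have "\<dots> = \<epsilon> * norm ?P" unfolding fac using \<epsilon> by (simp add: norm_mult)
  finally have "\<alpha> * \<eta> * E * (norm (x - complex_of_real r1) * norm (x - complex_of_real r2) * norm (x - complex_of_real r3)) =
      \<epsilon> * norm ?P" .
  moreover have "\<bar>Im x\<bar> ^ 3 \<le> norm (x - complex_of_real r1) * norm (x - complex_of_real r2) * norm (x - complex_of_real r3)"
  proof -
    have "\<bar>Im x\<bar> \<le> norm (x - complex_of_real r)" for r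
      using abs_Im_le_cmod[of "x - complex_of_real r"] by simp
    then show ?thesis unfolding power3_eq_cube by (intro mult_mono) auto
  qed
  ultimately have "\<alpha> * \<eta> * E * \<bar>Im x\<bar> ^ 3 \<le> \<epsilon> * norm ?P"
    using pos E by (metis less_imp_le mult_left_mono mult_pos_pos)
  then have "E * (\<alpha> * \<eta> * E * \<bar>Im x\<bar> ^ 3) \<le> \<epsilon> * (E * norm ?P)"
    using E by (metis less_imp_le mult_left_mono mult.left_commute)
  also have "\<dots> \<le> \<epsilon> * (1 + (\<alpha> * \<eta>) * R)" using P \<epsilon> by (intro mult_left_mono) auto
  finally have "\<bar>Im x\<bar> ^ 3 * (\<alpha> * \<eta> * E\<^sup>2) \<le> (1 + \<alpha> * \<eta> * R) * \<epsilon>"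
    by (simp add: power2_eq_square mult_ac)
  moreover have "0 < \<alpha> * \<eta> * E\<^sup>2" using pos E by simp
  ultimately show ?thesis by (simp add: pos_le_divide_eq)
qed

lemma real_roots_imp_Im_tendsto_0:
  assumes \<eta>: "0 < \<eta>" "\<eta> < \<alpha>" and E: "0 < E"
    and roots: "cubic_root \<alpha> \<eta> E r1" "cubic_root \<alpha> \<eta> E r2" "cubic_root \<alpha> \<eta> E r3"
    and distinct: "r1 \<noteq> r2" "r1 \<noteq> r3" "r2 \<noteq> r3"
    and G: "\<And>w. 0 < Im w \<Longrightarrow> \<exists>x. G w = 1 / w + x\<^sup>2 \<and>
      w * x * (1 - complex_of_real \<alpha> * x) * (1 - complex_of_real \<eta> * x) = 1 - complex_of_real (\<alpha> * \<eta>) * x"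
  shows "((\<lambda>\<epsilon>. Im (G (complex_of_real E + \<i> * complex_of_real \<epsilon>))) \<longlongrightarrow> 0) (at_right 0)"
proof -
  define R where "R = 2 / \<eta> + 1 + 4 * (1 + \<alpha> * \<eta>) / (E * (\<alpha> * \<eta>))"
  define K where "K = (1 + \<alpha> * \<eta> * R) / (\<alpha> * \<eta> * E\<^sup>2)"
  have bound: "\<bar>Im (G (complex_of_real E + \<i> * complex_of_real \<epsilon>))\<bar> \<le> \<epsilon> / E\<^sup>2 + 2 * R * root 3 (K * \<epsilon>)"
    if \<epsilon>: "0 < \<epsilon>" for \<epsilon>
  proof -
    let ?w = "complex_of_real E + \<i> * complex_of_real \<epsilon>"
    obtain x where x: "G ?w = 1 / ?w + x\<^sup>2"
      "?w * x * (1 - complex_of_real \<alpha> * x) * (1 - complex_of_real \<eta> * x) = 1 - complex_of_real (\<alpha> * \<eta>) * x"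
      using G[of ?w] \<epsilon> by auto
    have Ew: "E \<le> norm ?w" using complex_Re_le_cmod[of ?w] by simp
    have xR: "norm x \<le> R" unfolding R_def by (rule cubic_solution_bound[OF \<eta> E Ew x(2)])
    have "\<bar>Im x\<bar> ^ 3 \<le> K * \<epsilon>" unfolding K_def
      by (rule real_roots_imp_Im_le[OF \<eta> E \<epsilon> roots distinct x(2) xR])
    then have "root 3 (\<bar>Im x\<bar> ^ 3) \<le> root 3 (K * \<epsilon>)" by (intro real_root_le_mono) auto
    then have Imx: "\<bar>Im x\<bar> \<le> root 3 (K * \<epsilon>)" by (simp add: real_root_power_cancel)
    have "\<bar>Im (x\<^sup>2)\<bar> = 2 * \<bar>Re x\<bar> * \<bar>Im x\<bar>" by (simp add: power2_eq_square abs_mult)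
    also have "\<dots> \<le> 2 * R * root 3 (K * \<epsilon>)"
      using Imx abs_Re_le_cmod[of x] xR by (intro mult_mono) auto
    finally have "\<bar>Im (x\<^sup>2)\<bar> \<le> 2 * R * root 3 (K * \<epsilon>)" .
    moreover have "\<bar>Im (1 / ?w)\<bar> \<le> \<epsilon> / E\<^sup>2"
    proof -
      have "E\<^sup>2 \<le> (norm ?w)\<^sup>2" using Ew E by (intro power_mono) auto
      moreover have "\<bar>Im (1 / ?w)\<bar> = \<epsilon> / (norm ?w)\<^sup>2" using \<epsilon> by (simp add: Im_divide')
      ultimately show ?thesis using E \<epsilon> by (simp add: frac_le)
    qed
    ultimately show ?thesis unfolding x(1) plus_complex.sel by linarith
  qed
  have "((\<lambda>\<epsilon>. \<epsilon> / E\<^sup>2 + 2 * R * root 3 (K * \<epsilon>)) \<longlongrightarrow> 0 / E\<^sup>2 + 2 * R * root 3 (K * 0)) (at_right 0)"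
    using E by (intro tendsto_intros) auto
  then have "((\<lambda>\<epsilon>. \<epsilon> / E\<^sup>2 + 2 * R * root 3 (K * \<epsilon>)) \<longlongrightarrow> 0) (at_right 0)" by simp
  then show ?thesis
  proof (rule Lim_null_comparison[rotated])
    show "\<forall>\<^sub>F \<epsilon> in at_right 0. norm (Im (G (complex_of_real E + \<i> * complex_of_real \<epsilon>))) \<le> \<epsilon> / E\<^sup>2 + 2 * R * root 3 (K * \<epsilon>)"
      using eventually_at_right_less[of "0::real"] by eventually_elim (use bound in auto)
  qed
qed

text \<open>
  The Poisson kernel \<open>h / ((E - t\<^sup>2)\<^sup>2 + h\<^sup>2)\<close> is at least \<open>1 / (2h)\<close> where
  \<open>\<bar>t\<^sup>2 - E\<bar> \<le> h\<close>.
\<close>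

lemma measure_le_Im_cauchy_square:
  assumes fin: "finite_measure M" and sets [measurable_cong]: "sets M = sets borel" and h: "0 < h"
  shows "measure M {t. \<bar>t\<^sup>2 - E\<bar> \<le> h} \<le> 2 * h * \<bar>Im (cauchy_square M (complex_of_real E + \<i> * complex_of_real h))\<bar>"
proof -
  interpret finite_measure M by (rule fin)
  let ?w = "complex_of_real E + \<i> * complex_of_real h"
  let ?k = "\<lambda>t. 1 / (?w - (complex_of_real t)\<^sup>2)"
  have w: "?w - (complex_of_real t)\<^sup>2 = Complex (E - t\<^sup>2) h" for t
    by (simp add: complex_eq_iff flip: of_real_power)
  have Im: "- Im (?k t) = h / ((E - t\<^sup>2)\<^sup>2 + h\<^sup>2)" for t
    unfolding w by (simp add: Im_divide' cmod_def)
  have int: "integrable M ?k"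
  proof (rule cauchy_square_integrable[OF fin sets h], rule AE_I2)
    show "h \<le> norm (?w - (complex_of_real t)\<^sup>2)" for t
      using abs_Im_le_cmod[of "Complex (E - t\<^sup>2) h"] h unfolding w by simp
  qed
  have set: "{t. \<bar>t\<^sup>2 - E\<bar> \<le> h} \<in> Sigma_Algebra.sets M" unfolding sets by measurable
  have "measure M {t. \<bar>t\<^sup>2 - E\<bar> \<le> h} = (\<integral>t. indicator {t. \<bar>t\<^sup>2 - E\<bar> \<le> h} t \<partial>M)"
    using set by simp
  also have "\<dots> \<le> (\<integral>t. 2 * h * - Im (?k t) \<partial>M)"
  proof (rule integral_mono)
    show "integrable M (\<lambda>t. 2 * h * - Im (?k t))" using int by simp
    show "integrable M (indicat_real {t. \<bar>t\<^sup>2 - E\<bar> \<le> h})"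
      using set by (intro integrable_real_indicator) (auto simp: emeasure_eq_measure)
    fix t
    have pos: "0 < (E - t\<^sup>2)\<^sup>2 + h\<^sup>2" using h by (simp add: add_nonneg_pos)
    show "indicat_real {t. \<bar>t\<^sup>2 - E\<bar> \<le> h} t \<le> 2 * h * - Im (?k t)"
    proof (cases "\<bar>t\<^sup>2 - E\<bar> \<le> h")
      case True
      then have "\<bar>t\<^sup>2 - E\<bar>\<^sup>2 \<le> h\<^sup>2" by (intro power_mono) auto
      then have "(E - t\<^sup>2)\<^sup>2 \<le> h\<^sup>2" by (simp add: power2_commute)
      then have "1 \<le> 2 * h * (h / ((E - t\<^sup>2)\<^sup>2 + h\<^sup>2))"
        using pos by (simp add: power2_eq_square)
      then show ?thesis unfolding Im using True by simp
    next
      case False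
      then show ?thesis unfolding Im using pos h by simp
    qed
  qed
  also have "\<dots> = 2 * h * - Im (integral\<^sup>L M ?k)"
    using int by (simp add: integral_Im)
  also have "\<dots> \<le> 2 * h * \<bar>Im (cauchy_square M ?w)\<bar>"
    unfolding cauchy_square_def using h by (intro mult_left_mono) auto
  finally show ?thesis .
qed

text \<open>
  The Poisson bound shows that the distribution function \<open>N\<close> of \<open>t\<^sup>2\<close> has derivative zero
  at every point of the interval, so it is constant there.
\<close>

lemma not_in_support_if_Im_tendsto_0:
  assumes fin: "finite_measure M" and sets [measurable_cong]: "sets M = sets borel"
    and lim: "\<And>E. E \<in> {lo<..<hi} \<Longrightarrow>
      ((\<lambda>\<epsilon>. Im (cauchy_square M (complex_of_real E + \<i> * complex_of_real \<epsilon>))) \<longlongrightarrow> 0) (at_right 0)"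
    and t: "t\<^sup>2 \<in> {lo<..<hi}"
  shows "t \<notin> measure_support M"
proof -
  interpret finite_measure M by (rule fin)
  define N where "N = (\<lambda>E. measure M {t. t\<^sup>2 \<le> E})"
  have meas: "{t::real. t\<^sup>2 \<le> E} \<in> Sigma_Algebra.sets M" for E unfolding sets by measurable
  have step: "\<bar>N (E + h) - N E\<bar> \<le> 2 * \<bar>h\<bar> * \<bar>Im (cauchy_square M (complex_of_real E + \<i> * complex_of_real \<bar>h\<bar>))\<bar>"
    if "h \<noteq> 0" for E h
  proof -
    define e where "e = min E (E + h)"
    define e' where "e' = max E (E + h)"
    have "\<bar>N (E + h) - N E\<bar> = \<bar>N e' - N e\<bar>" by (auto simp: e_def e'_def max_def min_def)
    also have "N e' - N e = measure M ({t. t\<^sup>2 \<le> e'} - {t. t\<^sup>2 \<le> e})"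
      unfolding N_def by (subst finite_measure_Diff) (auto simp: meas e_def e'_def)
    also have "\<bar>\<dots>\<bar> \<le> measure M {t. \<bar>t\<^sup>2 - E\<bar> \<le> \<bar>h\<bar>}"
    proof -
      have "{t::real. \<bar>t\<^sup>2 - E\<bar> \<le> \<bar>h\<bar>} \<in> Sigma_Algebra.sets M" unfolding sets by measurable
      then show ?thesis by (simp, intro finite_measure_mono) (auto simp: e_def e'_def)
    qed
    also have "\<dots> \<le> 2 * \<bar>h\<bar> * \<bar>Im (cauchy_square M (complex_of_real E + \<i> * complex_of_real \<bar>h\<bar>))\<bar>"
      by (rule measure_le_Im_cauchy_square[OF fin sets]) (use that in simp)
    finally show ?thesis .
  qed
  have deriv: "(N has_real_derivative 0) (at E)" if E: "E \<in> {lo<..<hi}" for E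
    unfolding DERIV_def
  proof (rule Lim_null_comparison)
    have "filterlim (\<lambda>h::real. \<bar>h\<bar>) (at_right 0) (at 0)"
      unfolding filterlim_at by (auto intro!: tendsto_eq_intros simp: eventually_at_filter)
    from filterlim_compose[OF lim[OF E] this]
    have "((\<lambda>h. 2 * \<bar>Im (cauchy_square M (complex_of_real E + \<i> * complex_of_real \<bar>h\<bar>))\<bar>) \<longlongrightarrow> 2 * \<bar>0\<bar>) (at 0)"
      by (intro tendsto_intros)
    then show "((\<lambda>h. 2 * \<bar>Im (cauchy_square M (complex_of_real E + \<i> * complex_of_real \<bar>h\<bar>))\<bar>) \<longlongrightarrow> 0) (at 0)"
      by simp
    show "\<forall>\<^sub>F h in at 0. norm ((N (E + h) - N E) / h) \<le> 2 * \<bar>Im (cauchy_square M (complex_of_real E + \<i> * complex_of_real \<bar>h\<bar>))\<bar>"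
      using eventually_neq_at_within[of "0::real" 0 UNIV]
    proof (rule eventually_mono)
      fix h :: real assume "h \<noteq> 0"
      then show "norm ((N (E + h) - N E) / h) \<le> 2 * \<bar>Im (cauchy_square M (complex_of_real E + \<i> * complex_of_real \<bar>h\<bar>))\<bar>"
        using step[of h E] by (simp add: divide_le_eq mult_ac)
    qed
  qed
  define e where "e = (lo + t\<^sup>2) / 2"
  define e' where "e' = (t\<^sup>2 + hi) / 2"
  have e: "lo < e" "e < t\<^sup>2" "t\<^sup>2 < e'" "e' < hi" using t by (auto simp: e_def e'_def field_simps)
  have "N e' = N e"
    by (rule DERIV_isconst3[of lo hi]) (use e deriv in auto)
  then have "measure M ({t. t\<^sup>2 \<le> e'} - {t. t\<^sup>2 \<le> e}) = 0"
    unfolding N_def using e by (subst finite_measure_Diff) (auto simp: meas)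
  then have "emeasure M ({t. t\<^sup>2 \<le> e'} - {t. t\<^sup>2 \<le> e}) = 0" by (simp add: emeasure_eq_measure)
  then have "emeasure M {s. e < s\<^sup>2 \<and> s\<^sup>2 < e'} = 0"
    by (rule emeasure_eq_0[rotated]) (use meas in auto)
  moreover have "open {s::real. e < s\<^sup>2 \<and> s\<^sup>2 < e'}"
    by (intro open_Collect_conj open_Collect_less continuous_intros)
  ultimately show ?thesis using e unfolding measure_support_def by auto
qed

lemma not_in_support_imp_null_squares:
  assumes sets: "sets M = sets borel" and sym: "symmetric_measure M"
    and t: "0 < t" "t \<notin> measure_support M"
  obtains d where "0 < d" "d < t" "AE s in M. s\<^sup>2 \<notin> {(t - d)\<^sup>2<..<(t + d)\<^sup>2}"
proof -
  obtain U where U: "open U" "t \<in> U" "emeasure M U = 0"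
    using t(2) unfolding measure_support_def by auto
  obtain r where r: "0 < r" "ball t r \<subseteq> U" using U open_contains_ball by metis
  define d where "d = min r (t / 2)"
  have d: "0 < d" "d < t" "d \<le> r" using r t by (auto simp: d_def)
  let ?I = "{t - d<..<t + d}"
  have "?I \<subseteq> U" using r d by (auto simp: dist_real_def subset_iff abs_if)
  then have I: "emeasure M ?I = 0" using U by (intro emeasure_eq_0[OF _ U(3)]) (auto simp: sets)
  have "emeasure M (uminus ` ?I) = emeasure (distr M borel uminus) ?I"
  proof -
    have "uminus -` ?I \<inter> space M = uminus ` ?I"
      using sets_eq_imp_space_eq[OF sets] by (force simp: image_iff)
    moreover have "uminus \<in> measurable M borel"
      unfolding measurable_cong_sets[OF sets refl] by measurable
    ultimately show ?thesis by (subst emeasure_distr) auto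
  qed
  then have I': "emeasure M (uminus ` ?I) = 0" using sym I by (simp add: symmetric_measure_def)
  have "uminus ` ?I = {- (t + d)<..<- (t - d)}" by simp
  have null: "?I \<union> uminus ` ?I \<in> null_sets M"
    using I I' by (intro null_sets.Un) (auto simp: null_sets_def sets)
  have "AE s in M. s \<notin> ?I \<union> uminus ` ?I" by (rule AE_not_in[OF null])
  then have "AE s in M. s\<^sup>2 \<notin> {(t - d)\<^sup>2<..<(t + d)\<^sup>2}"
  proof eventually_elim
    fix s assume s: "s \<notin> ?I \<union> uminus ` ?I"
    show "s\<^sup>2 \<notin> {(t - d)\<^sup>2<..<(t + d)\<^sup>2}"
    proof
      assume "s\<^sup>2 \<in> {(t - d)\<^sup>2<..<(t + d)\<^sup>2}"
      then have "t - d < \<bar>s\<bar>" "\<bar>s\<bar> < t + d"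
        using power2_less_imp_less[of "t - d" "\<bar>s\<bar>"] power2_less_imp_less[of "\<bar>s\<bar>" "t + d"] d t
        by auto
      then show False using s by (auto simp: abs_if split: if_splits)
    qed
  qed
  then show ?thesis using that d by blast
qed

section \<open>Shape of the support\<close>

lemma closed_measure_support: "closed (measure_support M)"
proof -
  have "- measure_support M = \<Union>{U. open U \<and> \<not> emeasure M U > 0}"
    unfolding measure_support_def by auto
  moreover have "open \<dots>" by (intro open_Union) auto
  ultimately show ?thesis by (simp add: closed_def)
qed

lemma interval_subset_measure_support:
  assumes "l < r" "{l<..<r} \<subseteq> measure_support M"
  shows "{l..r} \<subseteq> measure_support M"
  using closure_minimal[OF assms(2) closed_measure_support] assms(1) by simp

lemma measure_support_symmetric:
  assumes sym: "symmetric_measure M" and sets [measurable_cong]: "sets M = sets borel"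
    and t: "t \<in> measure_support M"
  shows "- t \<in> measure_support M"
  unfolding measure_support_def
proof (intro CollectI allI impI)
  fix U :: "real set" assume U: "open U" "- t \<in> U"
  then have Ub [measurable]: "U \<in> Sigma_Algebra.sets borel" by simp
  have "emeasure M U = emeasure (distr M borel uminus) U" using sym by (simp add: symmetric_measure_def)
  also have "\<dots> = emeasure M (uminus -` U \<inter> space M)" by (rule emeasure_distr) measurable
  also have "uminus -` U \<inter> space M = uminus -` U" using sets_eq_imp_space_eq[OF sets] by simp
  also have "emeasure M (uminus -` U) > 0"
  proof -
    have "open (uminus -` U)" using U by (intro open_vimage continuous_intros)
    moreover have "t \<in> uminus -` U" using U by simp
    ultimately show ?thesis using t unfolding measure_support_def by blast
  qed
  finally show "0 < emeasure M U" .
qed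

lemma measure_support_abs:
  assumes "symmetric_measure M" "sets M = sets borel"
  shows "t \<in> measure_support M \<longleftrightarrow> \<bar>t\<bar> \<in> measure_support M"
  using measure_support_symmetric[OF assms, of t] measure_support_symmetric[OF assms, of "- t"]
  by (auto simp: abs_if)

text \<open>
  The substitution \<open>u = \<alpha>\<eta>x - 1\<close> turns \<open>(\<alpha>\<eta>)\<^sup>2 x (1 - \<alpha>x)(1 - \<eta>x)\<close> into
  \<open>- (1 + u)(a + u)(b - u)\<close>.
\<close>

lemma cubic_root_branch:
  assumes \<eta>: "0 < \<eta>" "\<eta> < 1" and \<alpha>: "1 < \<alpha>" and E: "0 < E"
  defines "u \<equiv> \<lambda>x. \<alpha> * \<eta> * x - 1"
  shows "cubic_root \<alpha> \<eta> E x \<longleftrightarrow> u x \<noteq> 0 \<and> branch (1 - \<eta>) (\<alpha> - 1) (u x) = (\<alpha> * \<eta>)\<^sup>2 / E"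
proof -
  let ?N = "(1 + u x) * (1 - \<eta> + u x) * (\<alpha> - 1 - u x)"
  have "\<eta> * \<alpha> \<noteq> 0" "(\<alpha> * \<eta>)\<^sup>2 \<noteq> 0" using \<eta> \<alpha> by auto
  have N: "?N = - ((\<alpha> * \<eta>)\<^sup>2 * (x * (1 - \<alpha> * x) * (1 - \<eta> * x)))"
    unfolding u_def by (simp add: power2_eq_square) (simp add: algebra_simps)
  have "cubic_root \<alpha> \<eta> E x \<longleftrightarrow> E * (x * (1 - \<alpha> * x) * (1 - \<eta> * x)) = - u x"
    unfolding cubic_root_def u_def by (simp add: mult.assoc)
  also have "\<dots> \<longleftrightarrow> (\<alpha> * \<eta>)\<^sup>2 * (E * (x * (1 - \<alpha> * x) * (1 - \<eta> * x))) = (\<alpha> * \<eta>)\<^sup>2 * (- u x)"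
    using \<open>(\<alpha> * \<eta>)\<^sup>2 \<noteq> 0\<close> by (simp only: mult_cancel_left) simp
  also have "(\<alpha> * \<eta>)\<^sup>2 * (E * (x * (1 - \<alpha> * x) * (1 - \<eta> * x))) = - (E * ?N)" unfolding N by simp
  also have "- (E * ?N) = (\<alpha> * \<eta>)\<^sup>2 * (- u x) \<longleftrightarrow> E * ?N = (\<alpha> * \<eta>)\<^sup>2 * u x" by simp
  also have "\<dots> \<longleftrightarrow> u x \<noteq> 0 \<and> branch (1 - \<eta>) (\<alpha> - 1) (u x) = (\<alpha> * \<eta>)\<^sup>2 / E"
  proof (cases "u x = 0")
    case True
    then have "?N = (1 - \<eta>) * (\<alpha> - 1)" by simp
    then have "?N \<noteq> 0" using \<eta> \<alpha> by simp
    then show ?thesis using True E by simp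
  next
    case False
    then show ?thesis using E unfolding branch_def by (simp add: frac_eq_eq mult.commute)
  qed
  finally show ?thesis .
qed

lemma branch_pos_cases:
  assumes "0 < a" "a < 1" "0 < b" and "u \<noteq> 0" and pos: "0 < branch a b u"
  shows "u \<in> {- 1<..<- a} \<union> {0<..<b}"
proof (rule ccontr)
  assume "u \<notin> {- 1<..<- a} \<union> {0<..<b}"
  then consider "u \<le> - 1" | "- a \<le> u" "u < 0" | "b \<le> u" using \<open>u \<noteq> 0\<close> by fastforce
  then have "branch a b u \<le> 0"
  proof cases
    case 1
    then have "0 \<le> (1 + u) * (a + u) * (b - u)" using assms by (intro mult_nonneg_nonneg mult_nonpos_nonpos) auto
    then show ?thesis using 1 unfolding branch_def by (intro divide_nonneg_nonpos) auto
  next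
    case 2
    then have "0 \<le> (1 + u) * (a + u) * (b - u)" using assms by (intro mult_nonneg_nonneg) auto
    then show ?thesis using 2 unfolding branch_def by (intro divide_nonneg_nonpos) auto
  next
    case 3
    then have "(1 + u) * (a + u) * (b - u) \<le> 0" using assms by (intro mult_nonneg_nonpos mult_nonneg_nonneg) auto
    then show ?thesis using 3 assms unfolding branch_def by (intro divide_nonpos_nonneg) auto
  qed
  then show False using pos by simp
qed

text \<open>
  Sign changes are required of \<open>f\<close>, the level equation with its denominator cleared, because \<open>f\<close> is
  continuous across the pole of the branch at \<open>0\<close>.
\<close>

lemma three_cubic_roots:
  assumes \<eta>: "0 < \<eta>" "\<eta> < 1" and \<alpha>: "1 < \<alpha>" and E: "0 < E"
  defines "f \<equiv> \<lambda>u. (1 + u) * (1 - \<eta> + u) * (\<alpha> - 1 - u) - (\<alpha> * \<eta>)\<^sup>2 / E * u"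
  assumes ord: "x0 < x1" "x1 < x2" "x2 < x3"
    and s: "f x0 * f x1 < 0" "f x1 * f x2 < 0" "f x2 * f x3 < 0"
  obtains r1 r2 r3 where "cubic_root \<alpha> \<eta> E r1" "cubic_root \<alpha> \<eta> E r2" "cubic_root \<alpha> \<eta> E r3"
    "r1 \<noteq> r2" "r1 \<noteq> r3" "r2 \<noteq> r3"
proof -
  define c2 where "c2 = (\<alpha> - 1) - 1 - (1 - \<eta>)"
  define c1 where "c1 = (\<alpha> - 1) * (1 + (1 - \<eta>)) - (1 - \<eta>) - (\<alpha> * \<eta>)\<^sup>2 / E"
  define c0 where "c0 = (1 - \<eta>) * (\<alpha> - 1)"
  have f: "f u = (- 1) * u ^ 3 + c2 * u\<^sup>2 + c1 * u + c0" for u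
    unfolding f_def c2_def c1_def c0_def by (simp add: algebra_simps power2_eq_square power3_eq_cube)
  obtain u1 u2 u3 where u: "x0 < u1" "u1 < x1" "x1 < u2" "u2 < x2" "x2 < u3" "u3 < x3"
    and fac: "\<And>u :: real. of_real (- 1) * u ^ 3 + of_real c2 * u\<^sup>2 + of_real c1 * u + of_real c0 =
      of_real (- 1) * (u - of_real u1) * (u - of_real u2) * (u - of_real u3)"
    by (rule cubic_split_by_sign_changes[OF ord s[unfolded f], where 'a = real]) auto
  have root: "cubic_root \<alpha> \<eta> E ((1 + v) / (\<alpha> * \<eta>))" if v: "v \<in> {u1, u2, u3}" for v
  proof -
    have "f v = 0" using fac[of v] v unfolding f by auto
    then have fv: "(1 + v) * (1 - \<eta> + v) * (\<alpha> - 1 - v) = (\<alpha> * \<eta>)\<^sup>2 / E * v" by (simp add: f_def)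
    have "v \<noteq> 0" using fv \<eta> \<alpha> by auto
    moreover have "branch (1 - \<eta>) (\<alpha> - 1) v = (\<alpha> * \<eta>)\<^sup>2 / E"
      unfolding branch_def fv using \<open>v \<noteq> 0\<close> by simp
    moreover have "\<alpha> * \<eta> * ((1 + v) / (\<alpha> * \<eta>)) - 1 = v" using \<eta> \<alpha> by simp
    ultimately show ?thesis by (simp only: cubic_root_branch[OF \<eta> \<alpha> E]) simp
  qed
  have ne: "(1 + v) / (\<alpha> * \<eta>) \<noteq> (1 + w) / (\<alpha> * \<eta>)" if "v \<noteq> w" for v w
    using that \<eta> \<alpha> by simp
  show ?thesis
    by (rule that[of "(1 + u1) / (\<alpha> * \<eta>)" "(1 + u2) / (\<alpha> * \<eta>)" "(1 + u3) / (\<alpha> * \<eta>)"])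
      (rule root ne; use u in simp)+
qed

context
  fixes \<mu> :: "real measure" and \<alpha> \<eta> :: real
  assumes \<mu>: "real_distribution \<mu>" and sym: "symmetric_measure \<mu>"
    and \<eta>: "0 < \<eta>" "\<eta> < 1" and \<alpha>: "1 < \<alpha>"
    and neg: "\<And>E. E < 0 \<Longrightarrow> \<exists>x. cauchy_square \<mu> (complex_of_real E) = complex_of_real (1 / E + x\<^sup>2) \<and>
      E * x * (1 - \<alpha> * x) * (1 - \<eta> * x) = 1 - \<alpha> * \<eta> * x"
begin

interpretation real_distribution \<mu> by (rule \<mu>)

lemma finite_sets_\<mu>: "finite_measure \<mu>" "sets \<mu> = sets borel"
  by (unfold_locales, simp)

lemma \<eta>_less_\<alpha>: "\<eta> < \<alpha>" using \<eta> \<alpha> by simp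

lemma not_in_support_if_three_roots:
  assumes lo: "0 \<le> lo" and t: "t\<^sup>2 \<in> {lo<..<hi}"
    and roots: "\<And>E. E \<in> {lo<..<hi} \<Longrightarrow> \<exists>r1 r2 r3. cubic_root \<alpha> \<eta> E r1 \<and> cubic_root \<alpha> \<eta> E r2 \<and>
      cubic_root \<alpha> \<eta> E r3 \<and> r1 \<noteq> r2 \<and> r1 \<noteq> r3 \<and> r2 \<noteq> r3"
  shows "t \<notin> measure_support \<mu>"
proof (rule not_in_support_if_Im_tendsto_0[OF finite_sets_\<mu> _ t])
  fix E assume E: "E \<in> {lo<..<hi}"
  then obtain r1 r2 r3 where r: "cubic_root \<alpha> \<eta> E r1" "cubic_root \<alpha> \<eta> E r2" "cubic_root \<alpha> \<eta> E r3"
    "r1 \<noteq> r2" "r1 \<noteq> r3" "r2 \<noteq> r3" using roots by blast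
  show "((\<lambda>\<epsilon>. Im (cauchy_square \<mu> (complex_of_real E + \<i> * complex_of_real \<epsilon>))) \<longlongrightarrow> 0) (at_right 0)"
  proof (rule real_roots_imp_Im_tendsto_0[OF \<eta>(1) \<eta>_less_\<alpha> _ r])
    show "0 < E" using E lo by simp
    show "\<exists>x. cauchy_square \<mu> w = 1 / w + x\<^sup>2 \<and> w * x * (1 - complex_of_real \<alpha> * x) * (1 - complex_of_real \<eta> * x) =
        1 - complex_of_real (\<alpha> * \<eta>) * x" if "0 < Im w" for w
      by (rule cauchy_square_root_upper[OF finite_sets_\<mu> \<eta>(1) \<eta>_less_\<alpha> \<alpha> neg that]) auto
  qed
qed

text \<open>
  For \<open>s = t\<^sup>2\<close> outside the interval, \<open>E / (E - s)\<close> decreases in \<open>E\<close>, and by the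
  equation for \<open>G\<close> its integral is \<open>1 + E x\<^sup>2\<close>.
\<close>

lemma null_squares_decreasing:
  assumes lo: "0 \<le> lo" and E: "lo < E" "E < E'" "E' < hi"
    and null: "AE s in \<mu>. s\<^sup>2 \<notin> {lo<..<hi}"
  obtains x x' where "cubic_root \<alpha> \<eta> E x" "cubic_root \<alpha> \<eta> E' x'" "E' * x'\<^sup>2 \<le> E * x\<^sup>2"
proof -
  have away: "AE s in \<mu>. 2 * (min (e - lo) (hi - e) / 2) \<le> \<bar>e - s\<^sup>2\<bar>" for e
    using null by eventually_elim auto
  have pos: "0 < e" "0 < min (e - lo) (hi - e) / 2" if "lo < e" "e < hi" for e using that lo by auto
  have root: "\<exists>x. (\<integral>s. 1 / (e - s\<^sup>2) \<partial>\<mu>) = 1 / e + x\<^sup>2 \<and> cubic_root \<alpha> \<eta> e x" if "lo < e" "e < hi" for e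
    by (rule cauchy_square_root_real[OF finite_sets_\<mu> \<eta>(1) \<eta>_less_\<alpha> \<alpha> neg pos[OF that] away])
      (auto simp: cubic_root_def)
  have int: "integrable \<mu> (\<lambda>s. 1 / (e - s\<^sup>2))" if e: "lo < e" "e < hi" for e
  proof (rule integrable_const_bound)
    show "AE s in \<mu>. norm (1 / (e - s\<^sup>2)) \<le> 1 / (2 * (min (e - lo) (hi - e) / 2))"
      using away[of e]
    proof eventually_elim
      fix s assume "2 * (min (e - lo) (hi - e) / 2) \<le> \<bar>e - s\<^sup>2\<bar>"
      then show "norm (1 / (e - s\<^sup>2)) \<le> 1 / (2 * (min (e - lo) (hi - e) / 2))"
        unfolding real_norm_def abs_divide using pos(2)[OF e] by (intro frac_le) auto
    qed
  qed measurable
  obtain x where x: "(\<integral>s. 1 / (E - s\<^sup>2) \<partial>\<mu>) = 1 / E + x\<^sup>2" "cubic_root \<alpha> \<eta> E x" using root[of E] E by auto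
  obtain x' where x': "(\<integral>s. 1 / (E' - s\<^sup>2) \<partial>\<mu>) = 1 / E' + x'\<^sup>2" "cubic_root \<alpha> \<eta> E' x'" using root[of E'] E by auto
  have "(\<integral>s. E' * (1 / (E' - s\<^sup>2)) \<partial>\<mu>) \<le> (\<integral>s. E * (1 / (E - s\<^sup>2)) \<partial>\<mu>)"
  proof (rule integral_mono_AE)
    show "integrable \<mu> (\<lambda>s. E' * (1 / (E' - s\<^sup>2)))" "integrable \<mu> (\<lambda>s. E * (1 / (E - s\<^sup>2)))"
      using E by (intro integrable_mult_right int; simp)+
    show "AE s in \<mu>. E' * (1 / (E' - s\<^sup>2)) \<le> E * (1 / (E - s\<^sup>2))"
      using null
    proof eventually_elim
      fix s assume s: "s\<^sup>2 \<notin> {lo<..<hi}"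
      then have prod: "0 < (E - s\<^sup>2) * (E' - s\<^sup>2)"
        using E by (cases "s\<^sup>2 \<le> lo") (auto intro: mult_neg_neg)
      then have nz: "E - s\<^sup>2 \<noteq> 0" "E' - s\<^sup>2 \<noteq> 0" by auto
      have "E * (1 / (E - s\<^sup>2)) - E' * (1 / (E' - s\<^sup>2)) = (E * (E' - s\<^sup>2) - E' * (E - s\<^sup>2)) / ((E - s\<^sup>2) * (E' - s\<^sup>2))"
        using nz by (simp add: diff_frac_eq)
      also have "E * (E' - s\<^sup>2) - E' * (E - s\<^sup>2) = s\<^sup>2 * (E' - E)" by (simp add: algebra_simps)
      also have "0 \<le> s\<^sup>2 * (E' - E) / ((E - s\<^sup>2) * (E' - s\<^sup>2))" using prod E by (intro divide_nonneg_pos) auto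
      finally show "E' * (1 / (E' - s\<^sup>2)) \<le> E * (1 / (E - s\<^sup>2))" by simp
    qed
  qed
  then have "E' * (1 / E' + x'\<^sup>2) \<le> E * (1 / E + x\<^sup>2)"
    unfolding integral_mult_right_zero x(1) x'(1) .
  then have "E' * x'\<^sup>2 \<le> E * x\<^sup>2" using E lo by (simp add: distrib_left)
  then show ?thesis using that x(2) x'(2) by blast
qed

text \<open>
  \<open>V\<close> is a region that contains the solutions of the level equation over the interval. If no mass were
  near \<open>t\<^sup>2\<close>, take two energies \<open>t\<^sup>2 < E'\<close> in the gap. The larger energy has the lower level, hence
  the larger \<open>u\<close> and the larger \<open>x > 0\<close>; then \<open>E x\<^sup>2\<close> increases, against the monotonicity
  that a gap would force.
\<close>

lemma in_support_if_branch_decreasing: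
  assumes lo: "0 \<le> lo" and t: "0 < t" "t\<^sup>2 \<in> {lo<..<hi}"
    and V: "\<And>E u. E \<in> {lo<..<hi} \<Longrightarrow> u \<noteq> 0 \<Longrightarrow> branch (1 - \<eta>) (\<alpha> - 1) u = (\<alpha> * \<eta>)\<^sup>2 / E \<Longrightarrow> u \<in> V"
    and Vpos: "\<And>u. u \<in> V \<Longrightarrow> 0 < u"
    and dec: "\<And>u v. u \<in> V \<Longrightarrow> v \<in> V \<Longrightarrow> u < v \<Longrightarrow> branch (1 - \<eta>) (\<alpha> - 1) v < branch (1 - \<eta>) (\<alpha> - 1) u"
  shows "t \<in> measure_support \<mu>"
proof (rule ccontr)
  assume "t \<notin> measure_support \<mu>"
  then obtain d where d: "0 < d" "d < t" "AE s in \<mu>. s\<^sup>2 \<notin> {(t - d)\<^sup>2<..<(t + d)\<^sup>2}"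
    using not_in_support_imp_null_squares[OF finite_sets_\<mu>(2) sym t(1)] by metis
  define L where "L = max lo ((t - d)\<^sup>2)"
  define H where "H = min hi ((t + d)\<^sup>2)"
  have "(t - d)\<^sup>2 < t\<^sup>2" "t\<^sup>2 < (t + d)\<^sup>2" using d(1,2) by (auto intro!: power_strict_mono)
  then have LH: "0 \<le> L" "L < t\<^sup>2" "t\<^sup>2 < H" "lo \<le> L" "H \<le> hi" using t lo by (auto simp: L_def H_def)
  define E' where "E' = (t\<^sup>2 + H) / 2"
  have E': "t\<^sup>2 < E'" "E' < H" using LH by (auto simp: E'_def field_simps)
  have "AE s in \<mu>. s\<^sup>2 \<notin> {L<..<H}" using d(3) by eventually_elim (auto simp: L_def H_def)
  from null_squares_decreasing[OF LH(1,2) E' this]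
  obtain x x' where x: "cubic_root \<alpha> \<eta> (t\<^sup>2) x" "cubic_root \<alpha> \<eta> E' x'" "E' * x'\<^sup>2 \<le> t\<^sup>2 * x\<^sup>2" by metis
  define u where "u = \<alpha> * \<eta> * x - 1"
  define u' where "u' = \<alpha> * \<eta> * x' - 1"
  have tpos: "0 < t\<^sup>2" "0 < E'" using t E' less_trans[of 0 "t\<^sup>2" E'] by simp_all
  have u: "u \<noteq> 0" "branch (1 - \<eta>) (\<alpha> - 1) u = (\<alpha> * \<eta>)\<^sup>2 / t\<^sup>2"
    using x(1) cubic_root_branch[OF \<eta> \<alpha> tpos(1)] by (auto simp: u_def)
  have u': "u' \<noteq> 0" "branch (1 - \<eta>) (\<alpha> - 1) u' = (\<alpha> * \<eta>)\<^sup>2 / E'"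
    using x(2) cubic_root_branch[OF \<eta> \<alpha> tpos(2)] by (auto simp: u'_def)
  have uV: "u \<in> V" by (rule V[OF _ u]) (use t in simp)
  have u'V: "u' \<in> V" by (rule V[OF _ u']) (use t LH E' in simp)
  have "(\<alpha> * \<eta>)\<^sup>2 / E' < (\<alpha> * \<eta>)\<^sup>2 / t\<^sup>2"
    using E'(1) tpos \<eta> \<alpha> by (intro divide_strict_left_mono) auto
  then have "u < u'"
    using dec[OF u'V uV] u(2) u'(2) by (cases u u' rule: linorder_cases) auto
  then have "\<alpha> * \<eta> * x < \<alpha> * \<eta> * x'" by (simp add: u_def u'_def)
  then have "x < x'" using \<eta> \<alpha> by simp
  have "0 < \<alpha> * \<eta> * x" using Vpos[OF uV] by (simp add: u_def)
  then have "0 < x" by (rule zero_less_mult_pos) (use \<eta> \<alpha> in simp)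
  have "t\<^sup>2 * x\<^sup>2 < E' * x'\<^sup>2"
    using \<open>0 < x\<close> \<open>x < x'\<close> E'(1) tpos by (intro mult_strict_mono power_strict_mono) auto
  then show False using x(3) by simp
qed

private abbreviation (input) "h \<equiv> branch (1 - \<eta>) (\<alpha> - 1)"
private abbreviation (input) "\<kappa> \<equiv> (\<alpha> * \<eta>)\<^sup>2"

lemma branch_level:
  assumes "0 < E" "0 < h v"
  shows "\<kappa> / E < h v \<longleftrightarrow> \<kappa> / h v < E" "h v < \<kappa> / E \<longleftrightarrow> E < \<kappa> / h v"
  using assms by (simp_all add: field_simps)

text \<open>
  Two of the three solutions lie on either side of the maximum point \<open>u0\<close>, the third
  one in \<open>(0, b)\<close>.
\<close>

lemma support_above_edge:
  assumes u0: "- 1 < u0" "u0 < - (1 - \<eta>)" "0 < h u0" and t: "\<kappa> / h u0 < t\<^sup>2"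
  shows "t \<notin> measure_support \<mu>"
proof (rule not_in_support_if_three_roots)
  show "0 \<le> \<kappa> / h u0" using u0 by simp
  show "t\<^sup>2 \<in> {\<kappa> / h u0<..<t\<^sup>2 + 1}" using t by simp
  fix E assume E: "E \<in> {\<kappa> / h u0<..<t\<^sup>2 + 1}"
  have "0 < \<kappa>" using \<eta> \<alpha> by simp
  then have "0 < \<kappa> / h u0" using u0 by simp
  then have E0: "0 < E" using E by (auto intro: less_trans)
  have K: "\<kappa> / E < h u0" using branch_level(1)[OF E0 u0(3)] E by simp
  have K0: "0 < \<kappa> / E" using E0 \<open>0 < \<kappa>\<close> by simp
  let ?f = "\<lambda>u. (1 + u) * (1 - \<eta> + u) * (\<alpha> - 1 - u) - \<kappa> / E * u"
  have "u0 < 0" using u0 \<eta> by simp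
  have "?f u0 = u0 * h u0 - \<kappa> / E * u0" using \<open>u0 < 0\<close> by (simp add: branch_def)
  also have "\<dots> = u0 * (h u0 - \<kappa> / E)" by (simp only: right_diff_distrib mult.commute)
  finally have "?f u0 = u0 * (h u0 - \<kappa> / E)" .
  then have "?f u0 < 0" using K \<open>u0 < 0\<close> by (simp add: mult_neg_pos)
  moreover have "0 < ?f (- 1)" using K0 by simp
  moreover have "0 < ?f 0" using \<eta> \<alpha> by simp
  moreover have "?f (\<alpha> - 1) < 0"
  proof -
    have "0 < \<kappa> / E * (\<alpha> - 1)" using K0 \<alpha> by (intro mult_pos_pos) auto
    then show ?thesis by simp
  qed
  ultimately have signs: "?f (- 1) * ?f u0 < 0" "?f u0 * ?f 0 < 0" "?f 0 * ?f (\<alpha> - 1) < 0"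
    by (blast intro: mult_pos_neg mult_neg_pos)+
  show "\<exists>r1 r2 r3. cubic_root \<alpha> \<eta> E r1 \<and> cubic_root \<alpha> \<eta> E r2 \<and> cubic_root \<alpha> \<eta> E r3 \<and>
      r1 \<noteq> r2 \<and> r1 \<noteq> r3 \<and> r2 \<noteq> r3"
    by (rule three_cubic_roots[OF \<eta> \<alpha> E0 u0(1) \<open>u0 < 0\<close> _ signs]) (use \<alpha> in auto)
qed

text \<open>
  All three solutions lie in \<open>(0, b)\<close>, one on each monotone piece of the branch.
\<close>

lemma support_inside_gap:
  assumes u: "0 < ua" "ua < ub" "ub < \<alpha> - 1" and h: "0 < h ua" "h ua < h ub"
    and t: "\<kappa> / h ub < t\<^sup>2" "t\<^sup>2 < \<kappa> / h ua"
  shows "t \<notin> measure_support \<mu>"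
proof (rule not_in_support_if_three_roots)
  show "0 \<le> \<kappa> / h ub" using h by simp
  show "t\<^sup>2 \<in> {\<kappa> / h ub<..<\<kappa> / h ua}" using t by simp
  fix E assume E: "E \<in> {\<kappa> / h ub<..<\<kappa> / h ua}"
  have "0 < \<kappa>" using \<eta> \<alpha> by simp
  have hb: "0 < h ub" using h by simp
  then have "0 < \<kappa> / h ub" using \<open>0 < \<kappa>\<close> by simp
  then have E0: "0 < E" using E by (auto intro: less_trans)
  have K: "h ua < \<kappa> / E" "\<kappa> / E < h ub"
    using branch_level(2)[OF E0 h(1)] branch_level(1)[OF E0 hb] E by simp_all
  have K0: "0 < \<kappa> / E" using E0 \<open>0 < \<kappa>\<close> by simp
  let ?f = "\<lambda>u. (1 + u) * (1 - \<eta> + u) * (\<alpha> - 1 - u) - \<kappa> / E * u"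
  have fh: "?f u = u * (h u - \<kappa> / E)" if "0 < u" for u
  proof -
    have "?f u = u * h u - \<kappa> / E * u" using that by (simp add: branch_def)
    also have "\<dots> = u * (h u - \<kappa> / E)" by (simp only: right_diff_distrib mult.commute)
    finally show ?thesis .
  qed
  have "?f ua < 0" unfolding fh[OF u(1)] using K u by (simp add: mult_pos_neg)
  moreover have "0 < ?f ub" using fh[of ub] K u by simp
  moreover have "0 < ?f 0" using \<eta> \<alpha> by simp
  moreover have "?f (\<alpha> - 1) < 0"
  proof -
    have "0 < \<kappa> / E * (\<alpha> - 1)" using K0 \<alpha> by (intro mult_pos_pos) auto
    then show ?thesis by simp
  qed
  ultimately have signs: "?f 0 * ?f ua < 0" "?f ua * ?f ub < 0" "?f ub * ?f (\<alpha> - 1) < 0"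
    by (blast intro: mult_pos_neg mult_neg_pos)+
  show "\<exists>r1 r2 r3. cubic_root \<alpha> \<eta> E r1 \<and> cubic_root \<alpha> \<eta> E r2 \<and> cubic_root \<alpha> \<eta> E r3 \<and>
      r1 \<noteq> r2 \<and> r1 \<noteq> r3 \<and> r2 \<noteq> r3"
    by (rule three_cubic_roots[OF \<eta> \<alpha> E0 u signs]) blast
qed

lemma level_above_left_max:
  assumes u0: "0 < h u0" "\<And>u. - 1 \<le> u \<Longrightarrow> u \<le> - (1 - \<eta>) \<Longrightarrow> h u \<le> h u0"
    and u: "u \<noteq> 0" "h u0 < h u"
  shows "u \<in> {0<..<\<alpha> - 1}"
proof -
  have "u \<in> {- 1<..<- (1 - \<eta>)} \<union> {0<..<\<alpha> - 1}"
    by (rule branch_pos_cases) (use \<eta> \<alpha> u u0(1) in auto)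
  moreover have "u \<notin> {- 1<..<- (1 - \<eta>)}" using u0(2)[of u] u(2) by force
  ultimately show ?thesis by blast
qed

text \<open>
  The levels of the critical points of the branch give the end points: \<open>d\<close> belongs to the maximum
  on \<open>(-1, -a)\<close>, and in the presence of a gap \<open>c\<close> and \<open>b\<close> belong to the local minimum
  and the local maximum on \<open>(0, b)\<close>. The inclusions are proved on open intervals and extended
  to the end points because the support is closed.
\<close>

lemma support_structure:
  "(3 * root 3 ((1 - \<eta>) * (\<alpha> - 1)) < (\<alpha> - 1) - 1 - (1 - \<eta>) \<longrightarrow>
      \<not> connected (measure_support \<mu>) \<and>
      (\<exists>a b c d. 0 \<le> a \<and> a < b \<and> b < c \<and> c < d \<and> measure_support \<mu> \<inter> {0..} = {a..b} \<union> {c..d})) \<and>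
   (\<not> 3 * root 3 ((1 - \<eta>) * (\<alpha> - 1)) < (\<alpha> - 1) - 1 - (1 - \<eta>) \<longrightarrow> connected (measure_support \<mu>))"
proof -
  have ab: "0 < 1 - \<eta>" "1 - \<eta> < 1" "0 < \<alpha> - 1" using \<eta> \<alpha> by auto
  have \<kappa>: "0 < \<kappa>" using \<eta> \<alpha> by simp
  obtain u0 where u0: "- 1 < u0" "u0 < - (1 - \<eta>)" "0 < h u0"
    "\<And>u. - 1 \<le> u \<Longrightarrow> u \<le> - (1 - \<eta>) \<Longrightarrow> h u \<le> h u0"
    using branch_max_left[OF ab] by metis
  define d where "d = sqrt (\<kappa> / h u0)"
  have d: "0 < d" "d\<^sup>2 = \<kappa> / h u0" using \<kappa> u0 by (auto simp: d_def)
  have above: "t \<notin> measure_support \<mu>" if "d < t" for t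
    by (rule support_above_edge[OF u0(1-3)])
      (use power_strict_mono[OF that, of 2] d in \<open>simp add: less_imp_le\<close>)
  have sup_abs: "t \<in> measure_support \<mu> \<longleftrightarrow> \<bar>t\<bar> \<in> measure_support \<mu>" for t
    by (rule measure_support_abs[OF sym finite_sets_\<mu>(2)])
  show ?thesis
  proof (cases "3 * root 3 ((1 - \<eta>) * (\<alpha> - 1)) < (\<alpha> - 1) - 1 - (1 - \<eta>)")
    case False
    have "t \<in> measure_support \<mu>" if t: "0 < t" "t < d" for t
    proof (rule in_support_if_branch_decreasing[where lo = 0 and hi = "\<kappa> / h u0" and V = "{0<..}"])
      have "t\<^sup>2 < d\<^sup>2" using t by (intro power_strict_mono) auto
      then show "t\<^sup>2 \<in> {0<..<\<kappa> / h u0}" using t d by simp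
      show "u \<in> {0<..}" if E: "E \<in> {0<..<\<kappa> / h u0}" "u \<noteq> 0" "h u = \<kappa> / E" for E u
        using level_above_left_max[OF u0(3,4) E(2)] branch_level(2)[OF _ u0(3), of E] E by auto
      show "h v < h u" if "u \<in> {0<..}" "v \<in> {0<..}" "u < v" for u v
        using that False by (intro branch_decreasing ab) auto
    qed (use t in auto)
    then have "{0<..<d} \<subseteq> measure_support \<mu>" by auto
    then have sub: "{0..d} \<subseteq> measure_support \<mu>" by (rule interval_subset_measure_support[OF d(1)])
    have "t \<in> measure_support \<mu> \<longleftrightarrow> \<bar>t\<bar> \<le> d" for t
      using sub above[of "\<bar>t\<bar>"] sup_abs[of t] by (auto simp: not_le[symmetric])
    then have "measure_support \<mu> = {t. \<bar>t\<bar> \<le> d}" by (intro set_eqI) (simp only: mem_Collect_eq)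
    also have "\<dots> = {- d..d}" by auto
    finally have "measure_support \<mu> = {- d..d}" .
    then show ?thesis using False by simp
  next
    case True
    obtain ua ub where u: "0 < ua" "ua < ub" "ub < \<alpha> - 1"
      and dec_a: "\<And>u v. 0 < u \<Longrightarrow> u < v \<Longrightarrow> v \<le> ua \<Longrightarrow> h v < h u"
      and inc: "\<And>u v. ua \<le> u \<Longrightarrow> u < v \<Longrightarrow> v \<le> ub \<Longrightarrow> h u < h v"
      and dec_b: "\<And>u v. ub \<le> u \<Longrightarrow> u < v \<Longrightarrow> h v < h u"
      and left: "\<And>u. - 1 \<le> u \<Longrightarrow> u \<le> - (1 - \<eta>) \<Longrightarrow> h u < h ua"
      by (rule branch_turning_points[OF ab True], rule that) blast+
    have h: "h u0 < h ua" "h ua < h ub" "0 < h ua" "0 < h ub"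
      using left[of u0] inc[of ua ub] u u0 by auto
    define b where "b = sqrt (\<kappa> / h ub)"
    define c where "c = sqrt (\<kappa> / h ua)"
    have b: "0 < b" "b\<^sup>2 = \<kappa> / h ub" and c: "0 < c" "c\<^sup>2 = \<kappa> / h ua" using \<kappa> h by (auto simp: b_def c_def)
    have bcd: "b < c" "c < d"
      unfolding b_def c_def d_def using h u0 \<kappa> by (auto intro!: divide_strict_left_mono)
    have sqs: "\<And>s t. 0 < s \<Longrightarrow> s < t \<Longrightarrow> s\<^sup>2 < (t::real)\<^sup>2" by (intro power_strict_mono) auto
    have pos: "0 < h u" if "h u = \<kappa> / E" "0 < E" for u E using that \<kappa> by simp
    have low: "t \<in> measure_support \<mu>" if t: "0 < t" "t < b" for t
    proof (rule in_support_if_branch_decreasing[where lo = 0 and hi = "\<kappa> / h ub" and V = "{0<..ua}"])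
      show "t\<^sup>2 \<in> {0<..<\<kappa> / h ub}" using sqs[OF t] t b by simp
      show "v \<in> {0<..ua}" if E: "E \<in> {0<..<\<kappa> / h ub}" "v \<noteq> 0" "h v = \<kappa> / E" for E v
      proof -
        \<comment> \<open>beyond \<open>ua\<close> the branch stays below its local maximum \<open>h ub\<close>\<close>
        have hv: "h ub < h v" using branch_level(2)[OF _ h(4), of E] E by simp
        then have "0 < v" using level_above_left_max[OF u0(3,4) E(2)] h by auto
        moreover have "v \<le> ua"
          using hv inc[of v ub] dec_b[of ub v] by (cases "v < ub"; cases "v = ub") force+
        ultimately show ?thesis by simp
      qed
      show "h w < h v" if "v \<in> {0<..ua}" "w \<in> {0<..ua}" "v < w" for v w
        using that by (intro dec_a) auto
    qed (use t in auto)
    have high: "t \<in> measure_support \<mu>" if t: "c < t" "t < d" for t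
    proof (rule in_support_if_branch_decreasing[where lo = "\<kappa> / h ua" and hi = "\<kappa> / h u0" and V = "{ub..}"])
      have "0 < t" using t c by simp
      then show "0 < t" .
      show "t\<^sup>2 \<in> {\<kappa> / h ua<..<\<kappa> / h u0}" using sqs[OF c(1) t(1)] sqs[OF \<open>0 < t\<close> t(2)] c d by simp
      show "0 \<le> \<kappa> / h ua" using h by simp
      show "v \<in> {ub..}" if E: "E \<in> {\<kappa> / h ua<..<\<kappa> / h u0}" "v \<noteq> 0" "h v = \<kappa> / E" for E v
      proof -
        \<comment> \<open>before \<open>ub\<close> the branch stays above its local minimum \<open>h ua\<close>\<close>
        have "0 < \<kappa> / h ua" using \<kappa> h by simp
        then have "0 < E" using E by (auto intro: less_trans)
        then have hv: "h u0 < h v" "h v < h ua"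
          using branch_level(2)[OF _ u0(3), of E] branch_level(1)[OF _ h(3), of E] E by simp_all
        then have "0 < v" using level_above_left_max[OF u0(3,4) E(2)] by auto
        then show ?thesis
          using hv inc[of ua v] dec_a[of v ua] by (cases "v < ua"; cases "v = ua") force+
      qed
      show "h w < h v" if "v \<in> {ub..}" "w \<in> {ub..}" "v < w" for v w
        using that by (intro dec_b) auto
    qed (use u in auto)
    have gap: "t \<notin> measure_support \<mu>" if t: "b < t" "t < c" for t
    proof (rule support_inside_gap[OF u h(3,2)])
      have "0 < t" using t b by simp
      then show "\<kappa> / h ub < t\<^sup>2" "t\<^sup>2 < \<kappa> / h ua" using sqs[OF b(1) t(1)] sqs[OF _ t(2)] b c by auto
    qed
    have sub: "{0..b} \<subseteq> measure_support \<mu>" "{c..d} \<subseteq> measure_support \<mu>"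
      using low high b bcd by (intro interval_subset_measure_support; auto)+
    have eq: "measure_support \<mu> \<inter> {0..} = {0..b} \<union> {c..d}"
    proof (intro equalityI subsetI)
      fix t assume "t \<in> measure_support \<mu> \<inter> {0..}"
      then show "t \<in> {0..b} \<union> {c..d}" using gap[of t] above[of t] by force
    qed (use sub b c in auto)
    have "\<not> connected (measure_support \<mu>)"
    proof
      assume con: "connected (measure_support \<mu>)"
      have "b \<in> measure_support \<mu>" "c \<in> measure_support \<mu>" using sub b bcd by auto
      moreover have "b \<le> (b + c) / 2" "(b + c) / 2 \<le> c" using bcd by auto
      ultimately have "(b + c) / 2 \<in> measure_support \<mu>"
        using con unfolding connected_iff_interval by blast
      then show False using gap[of "(b + c) / 2"] bcd by simp
    qed
    then show ?thesis using True eq b bcd by blast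
  qed
qed

end

theorem corollary1p10:
  fixes \<nu> \<mu> :: "real measure" and \<alpha> \<eta> :: real
  assumes "real_distribution \<nu>"
    and "(\<integral>t. t \<partial>\<nu>) = 1"
    and "0 < \<eta>" and "\<eta> < \<alpha>"
    and "measure \<nu> {\<alpha>} > 0" and "measure \<nu> {\<eta>} > 0"
    and "measure \<nu> {\<alpha>, \<eta>} = 1"
    and "is_free_mult_conv \<nu> standard_semicircle \<mu>"
  shows "(\<not> connected (measure_support \<mu>) \<longleftrightarrow>
            \<alpha> > \<eta> * (3 / (1 - root 3 (1 - \<eta>)) - 1))
       \<and> (\<alpha> > \<eta> * (3 / (1 - root 3 (1 - \<eta>)) - 1) \<longrightarrow>
            (\<exists>a b c d. 0 \<le> a \<and> a < b \<and> b < c \<and> c < d \<and>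
               measure_support \<mu> \<inter> {0..} = {a..b} \<union> {c..d}))"
proof -
  have weights: "\<eta> < 1" "1 < \<alpha>" using two_atom_weights(3,4)[OF assms(1-7)] .
  have \<mu>: "real_distribution \<mu>" "symmetric_measure \<mu>" using assms(8) by (auto simp: is_free_mult_conv_def)
  have "\<exists>x. cauchy_square \<mu> (complex_of_real E) = complex_of_real (1 / E + x\<^sup>2) \<and>
      E * x * (1 - \<alpha> * x) * (1 - \<eta> * x) = 1 - \<alpha> * \<eta> * x" if "E < 0" for E
    by (rule free_conv_equation_negative[OF assms(1-8) that]) blast
  from support_structure[OF \<mu> assms(3) weights this]
  show ?thesis unfolding gap_condition_iff[OF assms(3) weights] by blast
qed

end
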